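(* Let $N\ge2$, let $(S_i)_{i\in\mathbb{Z}_N}$ be a representation of the Cuntz algebra $\mathcal{O}_N$ on a Hilbert space $\mathcal{H}$ and let $M$ be a minimal finite dimensional cyclic $(S_i^* )$-invariant subspace. Let $V_i$, $i\in\mathbb{Z}_N$, be the operators on $M$ defined by $V_i^*=S_i^*P_M$. Then (i) The representation is purely atomic if and only if $(V_i)_{i\in\mathbb{Z}_N}$ is block permutative. (ii) The representation is permutative if and only if $(V_i)_{i\in\mathbb{Z}_N}$ is permutative.
   Context: $\mathbb{Z}_N=\{0,1,\dots,N-1\}$. A representation of the Cuntz algebra $\mathcal{O}_N$ on a Hilbert space $\mathcal{H}$ is a family $(S_i)_{i\in\mathbb{Z}_N}$ of bounded operators on $\mathcal{H}$ with $S_i^*S_j=\delta_{ij}I$ for all $i,j$ and $\sum_{i\in\mathbb{Z}_N}S_iS_i^*=I$. For a finite word $I=i_1\dots i_n$, $S_I:=S_{i_1}\cdots S_{i_n}$ ($S_\emptyset$ is the identity). A subspace $M$ is $(S_i^* )$-invariant if $S_i^*M\subset M$ for all $i\in\mathbb{Z}_N$; it is cyclic if the closed linear span of $\{S_IS_J^*v:v\in M,\ I,J\text{ finite words}\}$ is $\mathcal{H}$. Minimal means minimal with respect to inclusion among the finite dimensional cyclic $(S_i^* )$-invariant subspaces. $P_M$ is the orthogonal projection onto $M$; thus $V_i^*$ is the restriction of $S_i^*$ to $M$, viewed as an operator on $M$, and $\sum_iV_iV_i^*=I$ on $M$. $\mathcal{K}_N=\mathbb{Z}_N^{\mathbb{N}}$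 is the space of infinite words with the product topology. The projection valued measure $P$ associated to the representation is the unique projection valued measure on the Borel sets of $\mathcal{K}_N$ with $P(\{\omega:\omega_1=i_1,\dots,\omega_k=i_k\})=S_IS_I^*$ for every finite word $I=i_1\dots i_k$. The representation is purely atomic if there is $\Omega\subset\mathcal{K}_N$ with $\oplus_{\omega\in\Omega}P(\{\omega\})=I$. The representation is permutative if there is an orthonormal basis of $\mathcal{H}$ which every $S_j$, $j\in\mathbb{Z}_N$, maps into itself. Let $(V_i)_{i\in\mathbb{Z}_N}$ be operators on a Hilbert space $M$ with $\sum_{i\in\mathbb{Z}_N}V_iV_i^*=I$. They are block permutative if there is a decomposition of $M$ into orthogonal subspaces $M=\oplus_{j\in J}M_j$ such that for every $j\in J$ and $i\in\mathbb{Z}_N$, the operator $V_i^*$ restricted to $M_j$ is either unitary onto some $M_{j'}$ with $j'\in J$ or constant $0$. They are permutative if there is an orthonormal basis $(e_j)_{j\in J}$ for $M$ such that for all $j\in J$ and $i\in\mathbb{Z}_N$, either $V_i^*e_j=e_{j'}$ for some $j'\in J$, or $V_i^*e_j=0$. *)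

theory Defs
  imports "HOL-Analysis.Analysis"
begin

text \<open>
  A complex Hilbert space is rendered as a complete real inner product space that also carries a
  complex structure; norm and topology are those of the underlying real space. The complex inner
  product is linear in the first argument.
\<close>

class complex_hilbert_space = real_inner + complete_space +
  fixes scaleC :: "complex \<Rightarrow> 'a \<Rightarrow> 'a"
    and cinner :: "'a \<Rightarrow> 'a \<Rightarrow> complex"
  assumes scaleC_add_right: "scaleC a (x + y) = scaleC a x + scaleC a y"
    and scaleC_add_left: "scaleC (a + b) x = scaleC a x + scaleC b x"
    and scaleC_scaleC: "scaleC a (scaleC b x) = scaleC (a * b) x"
    and scaleC_of_real: "scaleC (of_real r) x = scaleR r x"
    and cinner_add_left: "cinner (x + y) z = cinner x z + cinner y z"
    and cinner_scaleC_left: "cinner (scaleC a x) y = a * cinner x y"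
    and cinner_commute: "cinner y x = cnj (cinner x y)"
    and Re_cinner: "Re (cinner x y) = inner x y"

global_interpretation cvec: vector_space "scaleC :: complex \<Rightarrow> 'a \<Rightarrow> 'a::complex_hilbert_space"
proof
  show "scaleC 1 x = x" for x :: 'a
    using scaleC_of_real[of 1 x] by simp
qed (simp_all add: scaleC_add_right scaleC_add_left scaleC_scaleC)


section \<open>Operators on closed subspaces\<close>

text \<open>
  Operators on a closed subspace \<open>M\<close> are total functions of which only the values on \<open>M\<close> matter;
  operators on the whole Hilbert space are the case \<open>M = UNIV\<close>.
\<close>

definition operator_on :: "'a::complex_hilbert_space set \<Rightarrow> ('a \<Rightarrow> 'a) \<Rightarrow> bool" where
  "operator_on M T \<longleftrightarrow>
     T ` M \<subseteq> M \<and>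
     (\<forall>x\<in>M. \<forall>y\<in>M. T (x + y) = T x + T y) \<and>
     (\<forall>a. \<forall>x\<in>M. T (scaleC a x) = scaleC a (T x)) \<and>
     (\<exists>K. \<forall>x\<in>M. norm (T x) \<le> K * norm x)"

text \<open>
  For an operator \<open>T\<close> on a closed subspace \<open>M\<close> and \<open>y\<close> in \<open>M\<close> the vector below exists by the Riesz
  representation theorem. For \<open>y\<close> outside \<open>M\<close> the value is never used.
\<close>

definition adjoint_on ::
    "'a::complex_hilbert_space set \<Rightarrow> ('a \<Rightarrow> 'a) \<Rightarrow> 'a \<Rightarrow> 'a" where
  "adjoint_on M T y = (THE z. z \<in> M \<and> (\<forall>x\<in>M. cinner (T x) y = cinner x z))"

abbreviation adj :: "('a::complex_hilbert_space \<Rightarrow> 'a) \<Rightarrow> 'a \<Rightarrow> 'a" where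
  "adj \<equiv> adjoint_on UNIV"

definition proj_onto :: "'a::complex_hilbert_space set \<Rightarrow> 'a \<Rightarrow> 'a" where
  "proj_onto M x = (THE y. y \<in> M \<and> (\<forall>z\<in>M. cinner (x - y) z = 0))"

definition orthonormal_basis_of ::
    "'a::complex_hilbert_space set \<Rightarrow> 'a set \<Rightarrow> bool" where
  "orthonormal_basis_of M B \<longleftrightarrow>
     (\<forall>x\<in>B. \<forall>y\<in>B. cinner x y = (if x = y then 1 else 0)) \<and> closure (cvec.span B) = M"

definition unitary_between ::
    "'a::complex_hilbert_space set \<Rightarrow> 'a set \<Rightarrow> ('a \<Rightarrow> 'a) \<Rightarrow> bool" where
  "unitary_between A B T \<longleftrightarrow>
     T ` A = B \<and> (\<forall>x\<in>A. \<forall>y\<in>A. cinner (T x) (T y) = cinner x y)"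

text \<open>
  A decomposition is given by the set of its summands rather than by an indexed family: in a
  family of pairwise orthogonal subspaces only the zero subspace can occur more than once.
\<close>

definition orthogonal_decomposition ::
    "'a::complex_hilbert_space set \<Rightarrow> 'a set set \<Rightarrow> bool" where
  "orthogonal_decomposition M D \<longleftrightarrow>
     (\<forall>A\<in>D. cvec.subspace A \<and> closed A) \<and>
     (\<forall>A\<in>D. \<forall>B\<in>D. A \<noteq> B \<longrightarrow> (\<forall>x\<in>A. \<forall>y\<in>B. cinner x y = 0)) \<and>
     closure (cvec.span (\<Union>D)) = M"

definition block_permutative ::
    "nat \<Rightarrow> 'a::complex_hilbert_space set \<Rightarrow> (nat \<Rightarrow> 'a \<Rightarrow> 'a) \<Rightarrow> bool" where
  "block_permutative N M V \<longleftrightarrow>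
     (\<exists>D. orthogonal_decomposition M D \<and>
       (\<forall>A\<in>D. \<forall>i<N. (\<exists>B\<in>D. unitary_between A B (adjoint_on M (V i))) \<or>
                     (\<forall>x\<in>A. adjoint_on M (V i) x = 0)))"

definition permutative ::
    "nat \<Rightarrow> 'a::complex_hilbert_space set \<Rightarrow> (nat \<Rightarrow> 'a \<Rightarrow> 'a) \<Rightarrow> bool" where
  "permutative N M V \<longleftrightarrow>
     (\<exists>B. orthonormal_basis_of M B \<and>
       (\<forall>e\<in>B. \<forall>i<N. adjoint_on M (V i) e \<in> B \<or> adjoint_on M (V i) e = 0))"


section \<open>Representations of the Cuntz algebra\<close>

definition cuntz_representation ::
    "nat \<Rightarrow> (nat \<Rightarrow> 'a::complex_hilbert_space \<Rightarrow> 'a) \<Rightarrow> bool" where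
  "cuntz_representation N S \<longleftrightarrow>
     (\<forall>i<N. operator_on UNIV (S i)) \<and>
     (\<forall>i<N. \<forall>j<N. \<forall>x. adj (S i) (S j x) = (if i = j then x else 0)) \<and>
     (\<forall>x. (\<Sum>i<N. S i (adj (S i) x)) = x)"

definition finite_words :: "nat \<Rightarrow> nat list set" where
  "finite_words N = lists {..<N}"

definition word_op :: "(nat \<Rightarrow> 'a \<Rightarrow> 'a) \<Rightarrow> nat list \<Rightarrow> 'a \<Rightarrow> 'a" where
  "word_op S I = foldr (\<lambda>i T. S i \<circ> T) I id"

definition adj_invariant ::
    "nat \<Rightarrow> (nat \<Rightarrow> 'a::complex_hilbert_space \<Rightarrow> 'a) \<Rightarrow> 'a set \<Rightarrow> bool" where
  "adj_invariant N S M \<longleftrightarrow> (\<forall>i<N. adj (S i) ` M \<subseteq> M)"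

definition cyclic ::
    "nat \<Rightarrow> (nat \<Rightarrow> 'a::complex_hilbert_space \<Rightarrow> 'a) \<Rightarrow> 'a set \<Rightarrow> bool" where
  "cyclic N S M \<longleftrightarrow>
     closure (cvec.span {word_op S I (adj (word_op S J) v) | I J v.
       I \<in> finite_words N \<and> J \<in> finite_words N \<and> v \<in> M}) = UNIV"

definition fd_cyclic_invariant ::
    "nat \<Rightarrow> (nat \<Rightarrow> 'a::complex_hilbert_space \<Rightarrow> 'a) \<Rightarrow> 'a set \<Rightarrow> bool" where
  "fd_cyclic_invariant N S M \<longleftrightarrow>
     cvec.subspace M \<and> (\<exists>F. finite F \<and> M = cvec.span F) \<and> adj_invariant N S M \<and> cyclic N S M"

definition minimal_fd_cyclic_invariant ::
    "nat \<Rightarrow> (nat \<Rightarrow> 'a::complex_hilbert_space \<Rightarrow> 'a) \<Rightarrow> 'a set \<Rightarrow> bool" where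
  "minimal_fd_cyclic_invariant N S M \<longleftrightarrow>
     fd_cyclic_invariant N S M \<and> (\<forall>M'. fd_cyclic_invariant N S M' \<longrightarrow> M' \<subseteq> M \<longrightarrow> M' = M)"

definition permutative_representation ::
    "nat \<Rightarrow> (nat \<Rightarrow> 'a::complex_hilbert_space \<Rightarrow> 'a) \<Rightarrow> bool" where
  "permutative_representation N S \<longleftrightarrow>
     (\<exists>B. orthonormal_basis_of UNIV B \<and> (\<forall>j<N. S j ` B \<subseteq> B))"


section \<open>The associated projection valued measure\<close>

definition orthogonal_projection :: "('a::complex_hilbert_space \<Rightarrow> 'a) \<Rightarrow> bool" where
  "orthogonal_projection E \<longleftrightarrow> operator_on UNIV E \<and> E \<circ> E = E \<and> adj E = E"

text \<open>The measure argument serves only as a measurable space; values of \<open>P\<close> off \<open>sets X\<close> are irrelevant.\<close>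

definition projection_valued_measure ::
    "'b measure \<Rightarrow> ('b set \<Rightarrow> 'a::complex_hilbert_space \<Rightarrow> 'a) \<Rightarrow> bool" where
  "projection_valued_measure X P \<longleftrightarrow>
     (\<forall>A\<in>sets X. orthogonal_projection (P A)) \<and>
     P {} = (\<lambda>x. 0) \<and> P (space X) = id \<and>
     (\<forall>A\<in>sets X. \<forall>B\<in>sets X. P (A \<inter> B) = P A \<circ> P B) \<and>
     (\<forall>A :: nat \<Rightarrow> 'b set. range A \<subseteq> sets X \<longrightarrow> disjoint_family A \<longrightarrow>
       (\<forall>x. (\<lambda>n. P (A n) x) sums P (\<Union>n. A n) x))"

definition infinite_words :: "nat \<Rightarrow> (nat \<Rightarrow> nat) topology" where
  "infinite_words N = product_topology (\<lambda>_. discrete_topology {..<N}) UNIV"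

definition borel_words :: "nat \<Rightarrow> (nat \<Rightarrow> nat) measure" where
  "borel_words N = sigma (topspace (infinite_words N)) {U. openin (infinite_words N) U}"

text \<open>Letters of infinite words are numbered from 0.\<close>

definition cylinder :: "nat \<Rightarrow> nat list \<Rightarrow> (nat \<Rightarrow> nat) set" where
  "cylinder N I = {\<omega> \<in> topspace (infinite_words N). \<forall>k<length I. \<omega> k = I ! k}"

definition associated_pvm ::
    "nat \<Rightarrow> (nat \<Rightarrow> 'a::complex_hilbert_space \<Rightarrow> 'a) \<Rightarrow> ((nat \<Rightarrow> nat) set \<Rightarrow> 'a \<Rightarrow> 'a) \<Rightarrow> bool" where
  "associated_pvm N S P \<longleftrightarrow>
     projection_valued_measure (borel_words N) P \<and>
     (\<forall>I\<in>finite_words N. P (cylinder N I) = word_op S I \<circ> adj (word_op S I))"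

text \<open>
  The associated projection valued measure exists and is unique on Borel sets, so quantifying it
  existentially refers to that measure. The direct sum of projections is understood in the strong
  operator topology; the summands are mutually orthogonal because \<open>P\<close> is multiplicative.
\<close>

definition purely_atomic ::
    "nat \<Rightarrow> (nat \<Rightarrow> 'a::complex_hilbert_space \<Rightarrow> 'a) \<Rightarrow> bool" where
  "purely_atomic N S \<longleftrightarrow>
     (\<exists>P \<Omega>. associated_pvm N S P \<and> \<Omega> \<subseteq> topspace (infinite_words N) \<and>
       (\<forall>x. ((\<lambda>\<omega>. P {\<omega>} x) has_sum x) \<Omega>))"

end

theory Submission
  imports Defs
begin

text \<open>
  For an infinite word \<open>\<omega>\<close> let the atom space \<open>H\<^sub>\<omega>\<close> be the common range of the projections \<open>S\<^sub>I S\<^sub>I\<^sup>*\<close>, \<open>I\<close> running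
  through the prefixes of \<open>\<omega>\<close>; it is the range of \<open>P({\<omega>})\<close>. Atom spaces of different words are orthogonal,
  \<open>S\<^sub>i\<close> maps \<open>H\<^sub>\<omega>\<close> to \<open>H\<close> of the word \<open>i\<omega>\<close>, and \<open>S\<^sub>i\<^sup>*\<close> maps \<open>H\<^sub>\<omega>\<close> isometrically to \<open>H\<close> of the shifted word when \<open>i\<close>
  is the first letter of \<open>\<omega>\<close> and to zero otherwise. The representation is purely atomic exactly when
  the atom spaces are total (\<open>purely_atomic_iff_atomic\<close>); the measure is then a sum of projections to
  atom spaces, and all its laws can be checked on vectors of atom spaces.

  If the compression is block permutative, the adjoints act on every vector of a block by following
  one letter at a time, so the vector lies in an atom space (\<open>in_atom_space_of_coding\<close>). The atom spaces
  span a reducing subspace, which is everything because \<open>M\<close> is cyclic.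

  Conversely let the representation be purely atomic. The central fact
  (\<open>atom_component_eventually_periodic\<close>) is that a word in which some \<open>v \<in> M\<close> has a nonzero component \<open>w\<close> is
  eventually periodic, and that \<open>S\<^sub>I\<^sup>* w\<close> lies in \<open>M\<close> for some prefix \<open>I\<close>, the shifted word being periodic.
  This is a compactness argument: the vectors \<open>S\<^sub>I\<^sup>* v\<close> remain in the finite-dimensional space \<open>M\<close>, while
  infinitely many different shifts would make infinitely many of them nearly orthogonal, with norms
  bounded away from zero. Hence the pieces \<open>M \<inter> H\<^sub>\<eta>\<close> with \<open>\<eta>\<close> periodic span a cyclic invariant subspace of \<open>M\<close>, which is \<open>M\<close> by
  minimality. Recurrence along the period (\<open>S_periodic\<close>) shows that the adjoints map these pieces onto
  one another, so they are the required blocks.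

  A permutative \<open>V\<close> with basis \<open>B\<close> of \<open>M\<close> gives the basis \<open>S\<^sub>I e\<close>, \<open>e \<in> B\<close>, of the whole space. Conversely, the
  vectors of a basis permuted by the representation lie in atom spaces, so the decomposition of \<open>M\<close>
  into pieces is available. Cyclicity now yields \<open>H\<^sub>\<eta> \<subseteq> M\<close> for periodic \<open>\<eta>\<close> (\<open>periodic_atom_space_subset\<close>), so
  that \<open>M\<close> contains enough vectors of the basis to generate the whole space; by minimality these span
  \<open>M\<close>.
\<close>

section \<open>Complex Hilbert spaces\<close>

lemma cinner_zero_left [simp]: "cinner 0 y = 0"
  using cinner_scaleC_left[of 0 0 y] by simp

lemma cinner_zero_right [simp]: "cinner x 0 = 0"
  using cinner_commute[of x 0] by simp

lemma cinner_add_right: "cinner x (y + z) = cinner x y + cinner x z"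
  by (metis cinner_add_left cinner_commute complex_cnj_add)

lemma cinner_scaleC_right: "cinner x (scaleC a y) = cnj a * cinner x y"
  by (metis cinner_scaleC_left cinner_commute complex_cnj_mult)

lemma cinner_diff_left: "cinner (x - y) z = cinner x z - cinner y z"
  using cinner_add_left[of "x - y" y z] by simp

lemma cinner_diff_right: "cinner x (y - z) = cinner x y - cinner x z"
  using cinner_add_right[of x "y - z" z] by simp

lemma cinner_self: "cinner x x = of_real ((norm x)\<^sup>2)"
proof -
  have "Im (cinner x x) = 0"
    using cinner_commute[of x x] by (metis cnj.simps(2) neg_equal_zero)
  then show ?thesis
    by (simp add: complex_eq_iff Re_cinner power2_norm_eq_inner)
qed

lemma Im_cinner: "Im (cinner x y) = inner (scaleC (- \<i>) x) y"
  using cinner_scaleC_left[of "- \<i>" x y] by (simp flip: Re_cinner)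

lemma cinner_eq_zeroI: "cinner x y = 0" if "inner x y = 0" "inner (scaleC (- \<i>) x) y = 0"
  using that by (simp add: complex_eq_iff Re_cinner Im_cinner)

lemma cinner_self_eq_zero [simp]: "cinner x x = 0 \<longleftrightarrow> x = 0"
  by (simp add: cinner_self)

lemma cinner_zero_commute: "cinner x y = 0 \<longleftrightarrow> cinner y x = 0"
  by (metis cinner_commute complex_cnj_zero)

lemma norm_scaleC: "norm (scaleC a x) = cmod a * norm (x :: 'a::complex_hilbert_space)"
proof -
  have "cinner (scaleC a x) (scaleC a x) = of_real ((cmod a * norm x)\<^sup>2)"
    by (simp add: cinner_scaleC_left cinner_scaleC_right cinner_self[of x] power_mult_distrib
        complex_norm_square mult_ac del: of_real_power flip: of_real_power)
  then have "(norm (scaleC a x))\<^sup>2 = (cmod a * norm x)\<^sup>2"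
    unfolding cinner_self of_real_eq_iff .
  then show ?thesis
    by (simp add: power2_eq_iff_nonneg)
qed

lemma scaleR_scaleC: "scaleR r x = scaleC (of_real r) (x :: 'a::complex_hilbert_space)"
  by (simp add: scaleC_of_real)

lemma norm_cinner: "cmod (cinner x y) \<le> norm x * norm (y :: 'a::complex_hilbert_space)"
proof (cases "cinner x y = 0")
  case False
  define c where "c = cinner x y"
  have "cinner (scaleC (cnj c) x) y = of_real ((cmod c)\<^sup>2)"
    unfolding cinner_scaleC_left c_def complex_norm_square by (rule mult.commute)
  then have "(cmod c)\<^sup>2 = inner (scaleC (cnj c) x) y"
    by (metis Re_cinner Re_complex_of_real)
  also have "\<dots> \<le> norm (scaleC (cnj c) x) * norm y"
    by (rule norm_cauchy_schwarz)
  finally have "cmod c * cmod c \<le> cmod c * (norm x * norm y)"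
    by (simp add: norm_scaleC power2_eq_square mult.assoc)
  then show ?thesis
    using False unfolding c_def by simp
qed simp

lemma bounded_bilinear_cinner: "bounded_bilinear (cinner :: 'a::complex_hilbert_space \<Rightarrow> 'a \<Rightarrow> complex)"
proof
  show "\<exists>K. \<forall>a b. cmod (cinner a (b :: 'a)) \<le> norm a * norm b * K"
    by (intro exI[of _ 1]) (simp add: norm_cinner)
qed (auto simp: cinner_add_left cinner_add_right scaleR_scaleC cinner_scaleC_left cinner_scaleC_right
    scaleR_conv_of_real)

lemma bounded_linear_scaleC: "bounded_linear (scaleC a :: 'a::complex_hilbert_space \<Rightarrow> 'a)"
  by (intro bounded_linear_intro[where K = "cmod a"])
    (auto simp: scaleC_add_right norm_scaleC mult.commute scaleR_scaleC scaleC_scaleC)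

lemma subspace_imp_real_subspace: "cvec.subspace K \<Longrightarrow> subspace K"
  by (auto simp: cvec.subspace_def subspace_def scaleR_scaleC)

lemma subspace_closure:
  fixes K :: "'a::complex_hilbert_space set"
  assumes K: "cvec.subspace K"
  shows "cvec.subspace (closure K)"
proof -
  have "scaleC a x \<in> closure K" if x: "x \<in> closure K" for a x
  proof -
    obtain s where "\<And>n. s n \<in> K" "s \<longlonglongrightarrow> x"
      using x unfolding closure_sequential by blast
    then have "\<And>n. scaleC a (s n) \<in> K" "(\<lambda>n. scaleC a (s n)) \<longlonglongrightarrow> scaleC a x"
      using cvec.subspace_scale[OF K] bounded_linear.tendsto[OF bounded_linear_scaleC] by auto
    then show ?thesis
      unfolding closure_sequential by (intro exI[of _ "\<lambda>n. scaleC a (s n)"]) auto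
  qed
  moreover have "x + y \<in> closure K" if xy: "x \<in> closure K" "y \<in> closure K" for x y
  proof -
    obtain s t where "\<And>n. s n \<in> K" "s \<longlonglongrightarrow> x" "\<And>n. t n \<in> K" "t \<longlonglongrightarrow> y"
      using xy unfolding closure_sequential by blast
    then have "\<And>n. s n + t n \<in> K" "(\<lambda>n. s n + t n) \<longlonglongrightarrow> x + y"
      using cvec.subspace_add[OF K] by (auto intro: tendsto_add)
    then show ?thesis
      unfolding closure_sequential by (intro exI[of _ "\<lambda>n. s n + t n"]) auto
  qed
  ultimately show ?thesis
    using closure_subset[of K] cvec.subspace_0[OF K] by (auto simp: cvec.subspace_def)
qed

abbreviation closed_span :: "'a::complex_hilbert_space set \<Rightarrow> 'a set" where
  "closed_span A \<equiv> closure (cvec.span A)"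

lemma closed_span_subspace: "cvec.subspace (closed_span A)"
  by (intro subspace_closure cvec.subspace_span)

lemma closed_span_superset: "A \<subseteq> closed_span A"
  using cvec.span_superset closure_subset by blast

lemma closed_span_base: "x \<in> A \<Longrightarrow> x \<in> closed_span A"
  using closed_span_superset by auto

lemma closed_span_zero: "0 \<in> closed_span A"
  using closed_span_subspace by (rule cvec.subspace_0)

lemma closed_span_minimal:
  "A \<subseteq> K \<Longrightarrow> cvec.subspace K \<Longrightarrow> closed K \<Longrightarrow> closed_span A \<subseteq> K"
  by (meson closure_minimal cvec.span_minimal)

lemma closed_orthogonal_complement:
  "cvec.subspace {x. \<forall>y\<in>A. cinner x y = 0} \<and> closed {x. \<forall>y\<in>A. cinner x y = 0}"
proof
  have "{x. \<forall>y\<in>A. cinner x y = 0} = (\<Inter>y\<in>A. (\<lambda>x. cinner x y) -` {0})"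
    by auto
  moreover have "closed ((\<lambda>x. cinner x y) -` {0})" for y :: 'a
    by (intro continuous_closed_vimage)
      (auto intro!: linear_continuous_at bounded_bilinear.bounded_linear_left bounded_bilinear_cinner)
  ultimately show "closed {x. \<forall>y\<in>A. cinner x y = 0}"
    by auto
qed (auto simp: cvec.subspace_def cinner_add_left cinner_scaleC_left)

lemma orthogonal_closed_span:
  assumes "x \<in> closed_span A" "y \<in> closed_span B" and "\<And>a b. a \<in> A \<Longrightarrow> b \<in> B \<Longrightarrow> cinner a b = 0"
  shows "cinner x y = 0"
proof -
  have *: "cinner x b = 0" if "b \<in> B" for b
  proof -
    have "closed_span A \<subseteq> {x. \<forall>b\<in>B. cinner x b = 0}"
      using assms(3) closed_orthogonal_complement[of B] by (intro closed_span_minimal) auto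
    then show ?thesis
      using assms(1) that by auto
  qed
  have "closed_span B \<subseteq> {y. \<forall>z\<in>{x}. cinner y z = 0}"
    using * closed_orthogonal_complement[of "{x}"]
    by (intro closed_span_minimal) (auto simp: cinner_zero_commute)
  then show ?thesis
    using assms(2) cinner_zero_commute by blast
qed

lemma orthogonal_total_zero:
  assumes "closed_span A = UNIV" "\<And>a. a \<in> A \<Longrightarrow> cinner a y = 0"
  shows "y = 0"
  using orthogonal_closed_span[of y A y "{y}"] assms closed_span_superset[of "{y}"] by auto

lemma operator_onD:
  assumes "operator_on UNIV T"
  shows "T (x + y) = T x + T y" "T (scaleC a x) = scaleC a (T x)" "bounded_linear T"
proof -
  show 1: "T (x + y) = T x + T y" "T (scaleC a x) = scaleC a (T x)" for x y a
    using assms by (auto simp: operator_on_def)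
  obtain K where "norm (T x) \<le> K * norm x" for x
    using assms by (auto simp: operator_on_def)
  then show "bounded_linear T"
    by (intro bounded_linear_intro[where K = K]) (auto simp: 1 scaleR_scaleC mult.commute)
qed

lemma operator_on_UNIVI:
  assumes "\<And>x y. T (x + y) = T x + T y" "\<And>a x. T (scaleC a x) = scaleC a (T x)"
    "\<And>x. norm (T x) \<le> K * norm x"
  shows "operator_on UNIV T"
  unfolding operator_on_def using assms by blast

lemma operator_on_compose:
  assumes "operator_on UNIV T" "operator_on UNIV U"
  shows "operator_on UNIV (T \<circ> U)"
proof -
  obtain K where "\<And>x. norm ((T \<circ> U) x) \<le> norm x * K"
    using bounded_linear.bounded[OF bounded_linear_compose[OF operator_onD(3)[OF assms(1)] operator_onD(3)[OF assms(2)]]]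
    by (auto simp: o_def)
  then show ?thesis
    by (intro operator_on_UNIVI[where K = K])
      (auto simp: operator_onD(1,2)[OF assms(1)] operator_onD(1,2)[OF assms(2)] mult.commute)
qed

lemma operator_on_add:
  assumes "operator_on UNIV T" "operator_on UNIV U"
  shows "operator_on UNIV (\<lambda>x. T x + U x)"
proof -
  obtain K L where "\<And>x. norm (T x) \<le> norm x * K" "\<And>x. norm (U x) \<le> norm x * L"
    using assms[THEN operator_onD(3), THEN bounded_linear.bounded] by metis
  then have "norm (T x + U x) \<le> (K + L) * norm x" for x
    using norm_triangle_ineq[of "T x" "U x"] by (smt (verit) distrib_left mult.commute)
  then show ?thesis
    by (intro operator_on_UNIVI[where K = "K + L"])
      (auto simp: operator_onD(1,2)[OF assms(1)] operator_onD(1,2)[OF assms(2)] scaleC_add_right)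
qed

lemma operator_on_id: "operator_on UNIV id"
  by (intro operator_on_UNIVI[where K = 1]) auto

lemma operator_vimage_subspace:
  assumes T: "operator_on UNIV T" and K: "cvec.subspace K" "closed K"
  shows "cvec.subspace (T -` K)" "closed (T -` K)"
proof -
  have "T 0 = 0"
    by (rule linear_0[OF bounded_linear.linear[OF operator_onD(3)[OF T]]])
  then show "cvec.subspace (T -` K)"
    using K by (auto simp: cvec.subspace_def operator_onD[OF T])
  show "closed (T -` K)"
    by (intro continuous_closed_vimage K(2) linear_continuous_at operator_onD(3)[OF T])
qed

text \<open>
  The energy \<open>\<parallel>x\<parallel>\<^sup>2 - 2 f x\<close> is bounded below on \<open>M\<close>, the parallelogram identity turns every minimising
  sequence into a Cauchy sequence, and the first-order condition at the minimiser is the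
  representation. The one statement yields both adjoints and orthogonal projections.
\<close>

lemma riesz_representation:
  fixes f :: "'a::complex_hilbert_space \<Rightarrow> real"
  assumes M: "subspace M" "closed M"
    and add: "\<And>x y. x \<in> M \<Longrightarrow> y \<in> M \<Longrightarrow> f (x + y) = f x + f y"
    and scale: "\<And>r x. x \<in> M \<Longrightarrow> f (scaleR r x) = r * f x"
    and bound: "\<And>x. x \<in> M \<Longrightarrow> \<bar>f x\<bar> \<le> K * norm x"
  shows "\<exists>z\<in>M. \<forall>x\<in>M. f x = inner x z"
proof -
  define q where "q x = (norm x)\<^sup>2 - 2 * f x" for x
  have "- (K\<^sup>2) \<le> q x" if "x \<in> M" for x
  proof -
    have "0 \<le> (norm x - K)\<^sup>2" by simp
    then show ?thesis
      using bound[OF that] by (simp add: q_def power2_eq_square algebra_simps)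
  qed
  then have bdd: "bdd_below (q ` M)"
    by (auto simp: bdd_below_def)
  define m where "m = Inf (q ` M)"
  have m_le: "m \<le> q x" if "x \<in> M" for x
    unfolding m_def using bdd that by (auto intro: cInf_lower)
  have ne: "q ` M \<noteq> {}"
    using M(1) by (auto simp: subspace_def)
  have "\<exists>z\<in>M. q z < m + 1 / Suc n" for n
    using cInf_lessD[OF ne, of "m + 1 / Suc n"] by (auto simp: m_def)
  then obtain z where z: "\<And>n. z n \<in> M" "\<And>n. q (z n) < m + 1 / Suc n"
    by metis
  have parallelogram: "(norm (x - y))\<^sup>2 = 2 * q x + 2 * q y - 4 * q ((1/2) *\<^sub>R (x + y))" if "x \<in> M" "y \<in> M" for x y
  proof -
    have "f ((1/2) *\<^sub>R (x + y)) = (f x + f y) / 2"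
      using M(1) that by (subst scale) (auto simp: add subspace_add)
    moreover have "(norm (x - y))\<^sup>2 + (norm (x + y))\<^sup>2 = 2 * (norm x)\<^sup>2 + 2 * (norm y)\<^sup>2"
      by (simp add: power2_norm_eq_inner algebra_simps inner_commute)
    ultimately show ?thesis
      by (simp add: q_def power_mult_distrib power_divide)
  qed
  have dist: "(norm (z i - z j))\<^sup>2 \<le> 2 / Suc i + 2 / Suc j" for i j
  proof -
    have "(1/2) *\<^sub>R (z i + z j) \<in> M"
      using M(1) z(1) by (simp add: subspace_add subspace_scale)
    then show ?thesis
      using parallelogram[OF z(1)[of i] z(1)[of j]] m_le[of "(1/2) *\<^sub>R (z i + z j)"] z(2)[of i] z(2)[of j]
      by simp
  qed
  have "Cauchy z"
  proof (rule metric_CauchyI)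
    fix e :: real assume e: "0 < e"
    obtain N where N: "1 / real (Suc N) < e\<^sup>2 / 4"
      using nat_approx_posE[of "e\<^sup>2 / 4"] e by auto
    have "dist (z i) (z j) < e" if "i \<ge> N" "j \<ge> N" for i j
    proof -
      have "1 / real (Suc i) \<le> 1 / real (Suc N)" "1 / real (Suc j) \<le> 1 / real (Suc N)"
        using that by (auto simp: frac_le)
      then have "(norm (z i - z j))\<^sup>2 < e\<^sup>2"
        using dist[of i j] N by simp
      then show ?thesis
        using e by (simp add: dist_norm power_less_imp_less_base)
    qed
    then show "\<exists>N. \<forall>i\<ge>N. \<forall>j\<ge>N. dist (z i) (z j) < e"
      by blast
  qed
  then obtain l where l: "z \<longlonglongrightarrow> l"
    using Cauchy_convergent convergent_def by blast
  have lM: "l \<in> M"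
    using M(2) z(1) l closed_sequentially by blast
  have fl: "(\<lambda>n. f (z n)) \<longlonglongrightarrow> f l"
  proof (rule LIM_zero_cancel, rule Lim_null_comparison)
    have "\<bar>f (z n) - f l\<bar> \<le> K * norm (z n - l)" for n
    proof -
      have "f (z n) = f (z n - l) + f l"
        using add[of "z n - l" l] z(1) lM M(1) by (simp add: subspace_diff)
      then show ?thesis
        using bound[of "z n - l"] z(1) lM M(1) by (simp add: subspace_diff)
    qed
    then show "\<forall>\<^sub>F n in sequentially. norm (f (z n) - f l) \<le> K * norm (z n - l)"
      by auto
    show "(\<lambda>n. K * norm (z n - l)) \<longlonglongrightarrow> 0"
      using tendsto_mult_right_zero[OF tendsto_norm_zero[OF LIM_zero[OF l]]] by simp
  qed
  have "(\<lambda>n. q (z n)) \<longlonglongrightarrow> q l"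
    unfolding q_def by (intro tendsto_intros fl l)
  moreover have "(\<lambda>n. m + 1 / Suc n) \<longlonglongrightarrow> m + 0"
    by (intro tendsto_intros LIMSEQ_Suc[OF lim_1_over_n])
  ultimately have ql: "q l \<le> m"
    using z(2) by (intro LIMSEQ_le[of "\<lambda>n. q (z n)" _ "\<lambda>n. m + 1 / Suc n"]) (auto intro: less_imp_le)
  have "f h = inner h l" if h: "h \<in> M" for h
  proof -
    define c where "c = inner h l - f h"
    define d where "d = (norm h)\<^sup>2 + 1"
    have "0 \<le> 2 * t * c + t\<^sup>2 * (norm h)\<^sup>2" for t
    proof -
      have "(norm (l + t *\<^sub>R h))\<^sup>2 = (norm l)\<^sup>2 + 2 * t * inner h l + t\<^sup>2 * (norm h)\<^sup>2"
        unfolding power2_norm_eq_inner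
        by (simp add: inner_add_left inner_add_right inner_commute[of l h] power2_eq_square algebra_simps)
      then have "q (l + t *\<^sub>R h) = q l + 2 * t * c + t\<^sup>2 * (norm h)\<^sup>2"
        using add[OF lM, of "t *\<^sub>R h"] h scale[OF h, of t] M(1)
        by (simp add: q_def c_def subspace_scale algebra_simps)
      moreover have "m \<le> q (l + t *\<^sub>R h)"
        using h lM M(1) by (intro m_le) (simp add: subspace_add subspace_scale)
      ultimately show ?thesis
        using ql by simp
    qed
    note quadratic = this
    have "0 \<le> 2 * (- c / d) * c + (- c / d)\<^sup>2 * (d - 1)"
      using quadratic[of "- c / d"] by (simp add: d_def)
    moreover have "d > 0"
      unfolding d_def by (smt (verit) zero_le_power2)
    moreover have "(2 * (- c / d) * c + (- c / d)\<^sup>2 * (d - 1)) * d\<^sup>2 = - (c\<^sup>2 * (d + 1))"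
      using \<open>d > 0\<close> by (simp add: field_simps power2_eq_square)
    ultimately have "c\<^sup>2 * (d + 1) \<le> 0"
      by (metis neg_0_le_iff_le zero_le_mult_iff zero_le_power2)
    then have "c = 0"
      using \<open>d > 0\<close> by (simp add: mult_le_0_iff)
    then show ?thesis
      by (simp add: c_def)
  qed
  then show ?thesis
    using lM by blast
qed

lemma adj_eq:
  assumes "operator_on UNIV T"
  shows "cinner (T x) y = cinner x (adj T y)"
proof -
  obtain K where K: "\<And>x. norm (T x) \<le> norm x * K"
    using bounded_linear.bounded[OF operator_onD(3)[OF assms]] by blast
  have "\<exists>z\<in>UNIV. \<forall>x\<in>UNIV. inner (T x) y = inner x z"
  proof (rule riesz_representation)
    show "\<bar>inner (T x) y\<bar> \<le> (K * norm y) * norm x" for x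
      using Cauchy_Schwarz_ineq2[of "T x" y] mult_right_mono[OF K[of x] norm_ge_zero[of y]]
      by (simp add: mult_ac)
    show "inner (T (r *\<^sub>R x)) y = r * inner (T x) y" for r x
      by (metis inner_scaleR_left operator_onD(2)[OF assms] scaleC_of_real)
  qed (auto simp: operator_onD(1)[OF assms] inner_add_left)
  then obtain z where z: "\<And>x. inner (T x) y = inner x z"
    by auto
  have *: "cinner (T x) y = cinner x z" for x
    using z[of x] z[of "scaleC (-\<i>) x"] by (simp add: complex_eq_iff Re_cinner Im_cinner operator_onD(2)[OF assms] del: cvec.scale_minus_left)
  have "adj T y = z"
    unfolding adjoint_on_def
  proof (rule the_equality)
    fix w assume "w \<in> UNIV \<and> (\<forall>x\<in>UNIV. cinner (T x) y = cinner x w)"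
    then have "cinner (w - z) (w - z) = 0"
      using *[of "w - z"] by (simp add: cinner_diff_right)
    then show "w = z"
      by simp
  qed (use * in auto)
  then show ?thesis
    using * by simp
qed

lemma adj_unique:
  assumes "operator_on UNIV T" "\<And>x. cinner (T x) y = cinner x z"
  shows "adj T y = z"
proof -
  have "cinner x (adj T y - z) = 0" for x
    using assms adj_eq[OF assms(1), of x y] by (simp add: cinner_diff_right)
  from this[of "adj T y - z"] show ?thesis
    by simp
qed

lemma proj_onto_unique:
  assumes "cvec.subspace M" "y \<in> M" "\<And>z. z \<in> M \<Longrightarrow> cinner (x - y) z = 0"
  shows "proj_onto M x = y"
  unfolding proj_onto_def
proof (rule the_equality)
  fix w assume w: "w \<in> M \<and> (\<forall>z\<in>M. cinner (x - w) z = 0)"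
  then have "y - w \<in> M"
    using assms cvec.subspace_diff by blast
  with w assms(3) have "cinner (x - w) (y - w) - cinner (x - y) (y - w) = 0"
    by auto
  then have "cinner (y - w) (y - w) = 0"
    by (simp flip: cinner_diff_left)
  then show "w = y"
    by simp
qed (use assms in auto)

lemma proj_onto_properties:
  assumes M: "cvec.subspace M" "closed M"
  shows proj_onto_in: "proj_onto M x \<in> M"
    and proj_onto_orthogonal: "z \<in> M \<Longrightarrow> cinner (x - proj_onto M x) z = 0"
proof -
  have "\<exists>y\<in>M. \<forall>z\<in>M. inner z x = inner z y"
    by (rule riesz_representation[where K = "norm x"])
      (use M in \<open>auto simp: subspace_imp_real_subspace inner_add_left Cauchy_Schwarz_ineq2 mult.commute[of "norm x"]\<close>)
  then obtain y where y: "y \<in> M" "\<And>z. z \<in> M \<Longrightarrow> inner z x = inner z y"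
    by blast
  have *: "cinner (x - y) z = 0" if z: "z \<in> M" for z
  proof -
    have "scaleC (- \<i>) z \<in> M"
      using M z cvec.subspace_scale by blast
    then have "cinner z (x - y) = 0"
      using y(2)[OF z] y(2)[of "scaleC (- \<i>) z"]
      by (intro cinner_eq_zeroI) (simp_all add: inner_diff_right)
    then show ?thesis
      using cinner_zero_commute by blast
  qed
  have "proj_onto M x = y"
    by (rule proj_onto_unique[OF M(1) y(1) *])
  then show "proj_onto M x \<in> M" "z \<in> M \<Longrightarrow> cinner (x - proj_onto M x) z = 0"
    using y(1) * by auto
qed

lemma proj_onto_same: "cvec.subspace M \<Longrightarrow> x \<in> M \<Longrightarrow> proj_onto M x = x"
  by (intro proj_onto_unique) auto

lemma proj_onto_zero:
  "cvec.subspace M \<Longrightarrow> (\<And>z. z \<in> M \<Longrightarrow> cinner x z = 0) \<Longrightarrow> proj_onto M x = 0"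
  by (intro proj_onto_unique) (auto simp: cvec.subspace_0)

lemma pythagoras:
  assumes "cinner x y = 0"
  shows "(norm (x + y))\<^sup>2 = (norm x)\<^sup>2 + (norm (y :: 'a::complex_hilbert_space))\<^sup>2"
proof -
  have "inner x y = 0"
    using assms by (simp flip: Re_cinner)
  then show ?thesis
    by (simp add: power2_norm_eq_inner algebra_simps inner_commute)
qed

lemma orthogonal_projection_proj_onto:
  assumes M: "cvec.subspace M" "closed M"
  shows "norm (proj_onto M x) \<le> norm x" "orthogonal_projection (proj_onto M)"
proof -
  note in_M = proj_onto_in[OF M] and orth = proj_onto_orthogonal[OF M]
  have bound: "norm (proj_onto M x) \<le> norm x" for x
  proof -
    have "(norm x)\<^sup>2 = (norm (x - proj_onto M x))\<^sup>2 + (norm (proj_onto M x))\<^sup>2"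
      using pythagoras[OF orth[OF in_M[of x], of x]] by simp
    then show ?thesis
      by (metis le_add_same_cancel2 norm_ge_zero power2_le_imp_le zero_le_power2)
  qed
  then show "norm (proj_onto M x) \<le> norm x" .
  have "proj_onto M (x + y) = proj_onto M x + proj_onto M y" for x y
    using M(1) in_M orth
    by (intro proj_onto_unique) (auto intro: cvec.subspace_add simp: cinner_add_left add_diff_add)
  moreover have "proj_onto M (scaleC a x) = scaleC a (proj_onto M x)" for a x
    using M(1) in_M orth
    by (intro proj_onto_unique)
      (auto intro: cvec.subspace_scale simp: cinner_scaleC_left simp flip: cvec.scale_right_diff_distrib)
  ultimately have op: "operator_on UNIV (proj_onto M)"
    using bound by (intro operator_on_UNIVI[where K = 1]) auto
  have "cinner (proj_onto M x) y = cinner x (proj_onto M y)" for x y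
  proof -
    have "cinner (x - proj_onto M x) (proj_onto M y) = 0" "cinner (proj_onto M x) (y - proj_onto M y) = 0"
      using orth in_M cinner_zero_commute by blast+
    then show ?thesis
      by (simp add: cinner_diff_left cinner_diff_right)
  qed
  then have "adj (proj_onto M) = proj_onto M"
    by (intro ext adj_unique[OF op])
  moreover have "proj_onto M \<circ> proj_onto M = proj_onto M"
    using proj_onto_same[OF M(1) in_M] by auto
  ultimately show "orthogonal_projection (proj_onto M)"
    unfolding orthogonal_projection_def using op by blast
qed

text \<open>
  Strong convergence of contractions is checked on a set with dense span only: the vectors on which
  it holds form a closed subspace.
\<close>

lemma contractions_tendsto_of_total:
  fixes Q :: "'i \<Rightarrow> 'a::complex_hilbert_space \<Rightarrow> 'a"
  assumes total: "closed_span G = UNIV"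
    and Q: "\<And>i. operator_on UNIV (Q i)" "\<And>i x. norm (Q i x) \<le> norm x"
    and R: "operator_on UNIV R" "\<And>x. norm (R x) \<le> norm x"
    and lim: "\<And>x. x \<in> G \<Longrightarrow> ((\<lambda>i. Q i x) \<longlongrightarrow> R x) F"
  shows "((\<lambda>i. Q i x) \<longlongrightarrow> R x) F"
proof -
  define K where "K = {x. ((\<lambda>i. Q i x) \<longlongrightarrow> R x) F}"
  have 0: "Q i 0 = 0" "R 0 = 0" for i
    using Q(2)[of i 0] R(2)[of 0] by auto
  have "cvec.subspace K"
    unfolding K_def cvec.subspace_def
    by (auto simp: operator_onD(1,2)[OF Q(1)] operator_onD(1,2)[OF R(1)] 0 intro!: tendsto_add
        bounded_linear.tendsto[OF bounded_linear_scaleC])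
  moreover have "closed K"
  proof -
    have "x \<in> K" if x: "x \<in> closure K" for x
      unfolding K_def mem_Collect_eq tendsto_iff
    proof (intro allI impI)
      fix e :: real assume e: "e > 0"
      obtain y where y: "y \<in> K" "dist y x < e / 3"
        using x e unfolding closure_approachable by (meson divide_pos_pos zero_less_numeral)
      have "\<forall>\<^sub>F i in F. dist (Q i y) (R y) < e / 3"
        using y(1) e tendstoD[of "\<lambda>i. Q i y" "R y" F "e / 3"] by (auto simp: K_def)
      then show "\<forall>\<^sub>F i in F. dist (Q i x) (R x) < e"
      proof (rule eventually_mono)
        fix i assume i: "dist (Q i y) (R y) < e / 3"
        have "dist (Q i x) (Q i y) \<le> dist x y" "dist (R x) (R y) \<le> dist x y"
          using Q(2)[of i "x - y"] R(2)[of "x - y"]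
            linear_diff[OF bounded_linear.linear[OF operator_onD(3)[OF Q(1)]]]
            linear_diff[OF bounded_linear.linear[OF operator_onD(3)[OF R(1)]]]
          by (auto simp: dist_norm)
        then show "dist (Q i x) (R x) < e"
          using i y(2) dist_triangle[of "Q i x" "R x" "Q i y"] dist_triangle[of "Q i y" "R x" "R y"]
          by (simp add: dist_commute)
      qed
    qed
    then show ?thesis
      using closure_subset_eq by blast
  qed
  moreover have "G \<subseteq> K"
    using lim by (auto simp: K_def)
  ultimately have "closed_span G \<subseteq> K"
    by (intro closed_span_minimal)
  then show ?thesis
    using total by (auto simp: K_def)
qed

lemma operators_eq_of_total:
  assumes total: "closed_span G = UNIV" and T: "operator_on UNIV T" "operator_on UNIV U"
    and eq: "\<And>x. x \<in> G \<Longrightarrow> T x = U x"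
  shows "T = U"
proof -
  have lin: "linear T" "linear U"
    using T by (auto intro: bounded_linear.linear operator_onD(3))
  have "cvec.subspace {x. T x = U x}"
    by (auto simp: cvec.subspace_def operator_onD(1,2)[OF T(1)] operator_onD(1,2)[OF T(2)] linear_0[OF lin(1)] linear_0[OF lin(2)])
  moreover have "closed {x. T x = U x}"
    using T by (intro closed_Collect_eq) (auto intro: linear_continuous_on operator_onD(3))
  ultimately have "closed_span G \<subseteq> {x. T x = U x}"
    using eq by (intro closed_span_minimal) auto
  then show ?thesis
    using total by auto
qed

section \<open>Finite-dimensional subspaces\<close>

lemma closed_of_bounded_subsequences:
  fixes A :: "'a::metric_space set"
  assumes "\<And>x :: nat \<Rightarrow> 'a. (\<And>n. x n \<in> A) \<Longrightarrow> bounded (range x) \<Longrightarrow>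
    \<exists>l\<in>A. \<exists>r. strict_mono r \<and> (x \<circ> r) \<longlonglongrightarrow> l"
  shows "closed A"
  unfolding closed_sequential_limits
proof (intro allI impI, elim conjE)
  fix y l assume y: "\<forall>n. y n \<in> A" "y \<longlonglongrightarrow> l"
  then obtain l' r where "l' \<in> A" "strict_mono r" "(y \<circ> r) \<longlonglongrightarrow> l'"
    using assms[of y] convergent_imp_bounded by blast
  then show "l \<in> A"
    using y(2) LIMSEQ_subseq_LIMSEQ LIMSEQ_unique by blast
qed

text \<open>
  Induction on the spanning set: a new vector \<open>a\<close> has positive distance from the closed span of the
  others, so the coefficient of \<open>a\<close> along a bounded sequence is bounded.
\<close>

lemma finite_span_bounded_subsequence:
  fixes x :: "nat \<Rightarrow> 'a::complex_hilbert_space"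
  assumes "finite F" "\<And>n. x n \<in> cvec.span F" "bounded (range x)"
  shows "\<exists>l\<in>cvec.span F. \<exists>r. strict_mono r \<and> (x \<circ> r) \<longlonglongrightarrow> l"
  using assms
proof (induction F arbitrary: x rule: finite_induct)
  case empty
  then have "x = (\<lambda>_. 0)"
    by auto
  then show ?case
    by (intro bexI[of _ 0] exI[of _ id]) (auto simp: strict_mono_def)
next
  case (insert a F)
  show ?case
  proof (cases "a \<in> cvec.span F")
    case True
    then show ?thesis
      using insert by (metis cvec.span_redundant)
  next
    case False
    have "closed (cvec.span F)"
      by (rule closed_of_bounded_subsequences) (rule insert.IH)
    define d where "d = infdist a (cvec.span F)"
    have "d > 0"
      using False infdist_nonneg[of a "cvec.span F"] cvec.span_zero[of F]
        in_closed_iff_infdist_zero[OF \<open>closed (cvec.span F)\<close>, of a]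
      unfolding d_def by fastforce
    obtain k where k: "\<And>n. x n - scaleC (k n) a \<in> cvec.span F"
    proof -
      have "\<exists>k. x n - scaleC k a \<in> cvec.span F" for n
        using insert.prems(1)[of n] by (simp add: cvec.span_insert)
      then show ?thesis
        using that by metis
    qed
    obtain C where C: "\<And>n. norm (x n) \<le> C"
      using insert.prems(2) by (auto simp: bounded_iff)
    have coeff: "cmod (k n) \<le> C / d" for n
    proof (cases "k n = 0")
      case False
      define y where "y = scaleC (- (1 / k n)) (x n - scaleC (k n) a)"
      have "y \<in> cvec.span F"
        unfolding y_def by (intro cvec.span_scale k)
      then have "d \<le> dist a y"
        unfolding d_def by (rule infdist_le)
      also have "dist a y = norm (scaleC (1 / k n) (x n))"
        using False by (simp add: y_def dist_norm cvec.scale_right_diff_distrib scaleC_scaleC)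
      also have "\<dots> = norm (x n) / cmod (k n)"
        by (simp add: norm_scaleC norm_divide)
      also have "\<dots> \<le> C / cmod (k n)"
        using C by (intro divide_right_mono) auto
      finally show ?thesis
        using False \<open>d > 0\<close> by (simp add: field_simps)
    next
      case True
      have "0 \<le> C"
        using C[of n] norm_ge_zero[of "x n"] by linarith
      then show ?thesis
        using True \<open>d > 0\<close> by simp
    qed
    then have "bounded (range k)"
      by (auto simp: bounded_iff)
    then obtain \<kappa> r where r: "strict_mono r" "(k \<circ> r) \<longlonglongrightarrow> \<kappa>"
      using bounded_imp_convergent_subsequence by blast
    define y where "y n = x (r n) - scaleC (k (r n)) a" for n
    have "norm (y n) \<le> C + C / d * norm a" for n
    proof -
      have "norm (y n) \<le> norm (x (r n)) + norm (scaleC (k (r n)) a)"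
        unfolding y_def by (rule norm_triangle_ineq4)
      also have "\<dots> \<le> C + C / d * norm a"
        using C[of "r n"] mult_right_mono[OF coeff[of "r n"] norm_ge_zero[of a]]
        by (intro add_mono) (auto simp: norm_scaleC)
      finally show ?thesis .
    qed
    then have "bounded (range y)"
      by (auto simp: bounded_iff)
    moreover have "y n \<in> cvec.span F" for n
      using k by (simp add: y_def)
    ultimately obtain l s where s: "l \<in> cvec.span F" "strict_mono s" "(y \<circ> s) \<longlonglongrightarrow> l"
      using insert.IH by blast
    have "((k \<circ> r) \<circ> s) \<longlonglongrightarrow> \<kappa>"
      by (rule LIMSEQ_subseq_LIMSEQ[OF r(2) s(2)])
    then have "(\<lambda>n. k (r (s n))) \<longlonglongrightarrow> \<kappa>"
      by (simp add: o_def)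
    moreover have "bounded_linear (\<lambda>c. scaleC c a)"
      by (intro bounded_linear_intro[where K = "norm a"])
        (auto simp: scaleC_add_left norm_scaleC scaleR_scaleC scaleC_scaleC scaleR_conv_of_real)
    ultimately have "(\<lambda>n. scaleC (k (r (s n))) a) \<longlonglongrightarrow> scaleC \<kappa> a"
      by (intro bounded_linear.tendsto[of "\<lambda>c. scaleC c a"])
    then have "(\<lambda>n. y (s n) + scaleC (k (r (s n))) a) \<longlonglongrightarrow> l + scaleC \<kappa> a"
      using s(3) by (intro tendsto_add) (auto simp: o_def)
    then have "(x \<circ> (r \<circ> s)) \<longlonglongrightarrow> l + scaleC \<kappa> a"
      by (simp add: y_def o_def)
    moreover have "l + scaleC \<kappa> a \<in> cvec.span (insert a F)"
      using s(1) by (auto simp: cvec.span_insert intro!: exI[of _ \<kappa>])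
    ultimately show ?thesis
      using strict_mono_o[OF r(1) s(2)] by blast
  qed
qed

lemma closed_finite_span:
  assumes "finite F"
  shows "closed (cvec.span F)"
  by (rule closed_of_bounded_subsequences) (rule finite_span_bounded_subsequence[OF assms])

lemma finite_span_subspace:
  assumes "finite F" "cvec.subspace K" "K \<subseteq> cvec.span F"
  shows "\<exists>G. finite G \<and> K = cvec.span G"
proof -
  obtain B where B: "B \<subseteq> K" "\<not> cvec.dependent B" "K \<subseteq> cvec.span B"
    using cvec.maximal_independent_subset[of K] by blast
  have "finite B"
    using cvec.independent_span_bound[OF assms(1) B(2)] B(1) assms(3) by blast
  moreover have "K = cvec.span B"
    using B assms(2) by (metis cvec.span_minimal subset_antisym)
  ultimately show ?thesis
    by blast
qed

section \<open>Words in a representation of the Cuntz algebra\<close>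

definition word_take :: "nat \<Rightarrow> (nat \<Rightarrow> nat) \<Rightarrow> nat list" where
  "word_take n \<omega> = map \<omega> [0..<n]"

definition word_drop :: "nat \<Rightarrow> (nat \<Rightarrow> nat) \<Rightarrow> nat \<Rightarrow> nat" where
  "word_drop n \<omega> = (\<lambda>k. \<omega> (n + k))"

definition word_append :: "nat list \<Rightarrow> (nat \<Rightarrow> nat) \<Rightarrow> nat \<Rightarrow> nat" where
  "word_append I \<omega> = (\<lambda>k. if k < length I then I ! k else \<omega> (k - length I))"

lemma length_word_take [simp]: "length (word_take n \<omega>) = n"
  by (simp add: word_take_def)

lemma word_take_0 [simp]: "word_take 0 \<omega> = []"
  by (simp add: word_take_def)

lemma nth_word_take [simp]: "k < n \<Longrightarrow> word_take n \<omega> ! k = \<omega> k"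
  by (simp add: word_take_def)

lemma word_take_add: "word_take (n + m) \<omega> = word_take n \<omega> @ word_take m (word_drop n \<omega>)"
  by (rule nth_equalityI) (auto simp: nth_append word_drop_def)

lemma word_take_Suc: "word_take (Suc n) \<omega> = \<omega> 0 # word_take n (word_drop 1 \<omega>)"
  using word_take_add[of 1 n \<omega>] by (simp add: word_take_def)

lemma word_drop_0 [simp]: "word_drop 0 \<omega> = \<omega>"
  by (simp add: word_drop_def)

lemma word_drop_drop: "word_drop m (word_drop n \<omega>) = word_drop (n + m) \<omega>"
  by (simp add: word_drop_def add.assoc)

lemma word_drop_append [simp]: "word_drop (length I) (word_append I \<omega>) = \<omega>"
  by (auto simp: word_drop_def word_append_def)

lemma word_take_append [simp]: "word_take (length I) (word_append I \<omega>) = I"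
  by (rule nth_equalityI) (auto simp: word_append_def)

lemma topspace_infinite_words: "topspace (infinite_words N) = {\<omega>. \<forall>k. \<omega> k < N}"
  by (auto simp: infinite_words_def)

lemma word_op_Nil [simp]: "word_op S [] x = x"
  by (simp add: word_op_def)

lemma word_op_Cons: "word_op S (i # I) x = S i (word_op S I x)"
  by (simp add: word_op_def)

lemma word_op_append: "word_op S (I @ J) x = word_op S I (word_op S J x)"
  by (induction I) (auto simp: word_op_Cons)

lemma finite_words_simps [simp]:
  "[] \<in> finite_words N"
  "i # I \<in> finite_words N \<longleftrightarrow> i < N \<and> I \<in> finite_words N"
  "I @ J \<in> finite_words N \<longleftrightarrow> I \<in> finite_words N \<and> J \<in> finite_words N"
  by (auto simp: finite_words_def)

locale cuntz =
  fixes N :: nat and S :: "nat \<Rightarrow> 'a::complex_hilbert_space \<Rightarrow> 'a"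
  assumes representation: "cuntz_representation N S"
begin

abbreviation T :: "nat \<Rightarrow> 'a \<Rightarrow> 'a" where "T i \<equiv> adj (S i)"

lemma S_operator: "i < N \<Longrightarrow> operator_on UNIV (S i)"
  using representation by (simp add: cuntz_representation_def)

lemma T_S: "i < N \<Longrightarrow> j < N \<Longrightarrow> T i (S j x) = (if i = j then x else 0)"
  using representation by (simp add: cuntz_representation_def)

lemma sum_S_T: "(\<Sum>i<N. S i (T i x)) = x"
  using representation by (simp add: cuntz_representation_def)

lemma cinner_S_T: "i < N \<Longrightarrow> cinner (S i x) y = cinner x (T i y)"
  by (rule adj_eq[OF S_operator])

abbreviation W :: "nat list \<Rightarrow> 'a \<Rightarrow> 'a" where "W \<equiv> word_op S"

abbreviation W' :: "nat list \<Rightarrow> 'a \<Rightarrow> 'a" where "W' I \<equiv> adj (W I)"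

lemma W_operator: "I \<in> finite_words N \<Longrightarrow> operator_on UNIV (W I)"
  by (induction I)
    (auto simp: word_op_def operator_on_id[unfolded id_def] id_def intro!: operator_on_compose S_operator)

lemma cinner_W: "I \<in> finite_words N \<Longrightarrow> cinner (W I x) y = cinner x (W' I y)"
  by (rule adj_eq[OF W_operator])

lemma W'_Nil [simp]: "W' [] x = x"
  by (rule adj_unique) (auto simp: W_operator)

lemma W'_append:
  "I \<in> finite_words N \<Longrightarrow> J \<in> finite_words N \<Longrightarrow> W' (I @ J) x = W' J (W' I x)"
  by (intro adj_unique) (auto simp: W_operator cinner_W word_op_append)

lemma W'_Cons: "i < N \<Longrightarrow> I \<in> finite_words N \<Longrightarrow> W' (i # I) x = W' I (T i x)"
  by (intro adj_unique) (auto simp: W_operator cinner_W cinner_S_T word_op_Cons)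

lemma W'_W:
  "I \<in> finite_words N \<Longrightarrow> J \<in> finite_words N \<Longrightarrow> length I = length J \<Longrightarrow>
    W' I (W J x) = (if I = J then x else 0)"
proof (induction I arbitrary: J)
  case (Cons i I)
  then obtain j J' where J: "J = j # J'"
    by (cases J) auto
  have "W' I 0 = 0"
    using Cons.prems by (intro adj_unique W_operator) auto
  moreover have "W' (i # I) (W J x) = W' I (T i (W (j # J') x))"
    using Cons.prems unfolding J by (intro W'_Cons) auto
  ultimately show ?case
    using Cons unfolding word_op_Cons by (auto simp: J T_S)
qed auto

lemma norm_W [simp]: "I \<in> finite_words N \<Longrightarrow> norm (W I x) = norm x"
proof -
  assume I: "I \<in> finite_words N"
  have "cinner (W I x) (W I x) = cinner x x"
    using I by (simp add: cinner_W W'_W)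
  then show ?thesis
    unfolding cinner_self of_real_eq_iff by (simp add: power2_eq_iff_nonneg)
qed

lemma norm_W'_le: "I \<in> finite_words N \<Longrightarrow> norm (W' I x) \<le> norm x"
proof -
  assume I: "I \<in> finite_words N"
  have "cinner (W I (W' I x)) x = of_real ((norm (W' I x))\<^sup>2)"
    using I by (simp add: cinner_W cinner_self)
  then have "(norm (W' I x))\<^sup>2 \<le> norm (W' I x) * norm x"
    using norm_cinner[of "W I (W' I x)" x] I by (simp add: norm_power)
  then show ?thesis
    by (cases "norm (W' I x) = 0") (auto simp: power2_eq_square)
qed

lemma W'_operator: "I \<in> finite_words N \<Longrightarrow> operator_on UNIV (W' I)"
proof (rule operator_on_UNIVI[where K = 1])
  assume I: "I \<in> finite_words N"
  show "W' I (x + y) = W' I x + W' I y" for x y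
    by (rule adj_unique[OF W_operator[OF I]]) (simp add: cinner_add_right cinner_W I)
  show "W' I (scaleC a x) = scaleC a (W' I x)" for a x
    by (rule adj_unique[OF W_operator[OF I]]) (simp add: cinner_scaleC_right cinner_W I)
qed (simp add: norm_W'_le)

lemma T_operator: "i < N \<Longrightarrow> operator_on UNIV (T i)"
  using W'_operator[of "[i]"] by (simp add: word_op_def)

lemma T_0: "i < N \<Longrightarrow> T i 0 = 0"
  by (rule linear_0[OF bounded_linear.linear[OF operator_onD(3)[OF T_operator]]])

lemma W_diff: "I \<in> finite_words N \<Longrightarrow> W I (x - y) = W I x - W I y"
  by (rule linear_diff[OF bounded_linear.linear[OF operator_onD(3)[OF W_operator]]])

lemma W'_diff: "I \<in> finite_words N \<Longrightarrow> W' I (x - y) = W' I x - W' I y"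
  by (rule linear_diff[OF bounded_linear.linear[OF operator_onD(3)[OF W'_operator]]])

lemma W_0: "I \<in> finite_words N \<Longrightarrow> W I 0 = 0"
  using W_diff[of I 0 0] by simp

lemma W'_0: "I \<in> finite_words N \<Longrightarrow> W' I 0 = 0"
  using W'_diff[of I 0 0] by simp

abbreviation words :: "(nat \<Rightarrow> nat) set" where "words \<equiv> {\<omega>. \<forall>k. \<omega> k < N}"

lemma word_take_finite_words [simp]: "\<omega> \<in> words \<Longrightarrow> word_take n \<omega> \<in> finite_words N"
  by (auto simp: finite_words_def word_take_def)

lemma word_drop_words: "\<omega> \<in> words \<Longrightarrow> word_drop n \<omega> \<in> words"
  by (auto simp: word_drop_def)

lemma word_append_words: "I \<in> finite_words N \<Longrightarrow> \<omega> \<in> words \<Longrightarrow> word_append I \<omega> \<in> words"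
  by (auto simp: word_append_def finite_words_def in_lists_conv_set)


section \<open>Atom spaces\<close>

text \<open>
  The decreasing projections \<open>S\<^sub>I S\<^sub>I\<^sup>*\<close> along the prefixes \<open>I\<close> of \<open>\<omega>\<close> have this space as common range;
  it is the range of \<open>P({\<omega>})\<close>, described without the measure.
\<close>

definition atom_space :: "(nat \<Rightarrow> nat) \<Rightarrow> 'a set" where
  "atom_space \<omega> = {x. \<forall>n. W (word_take n \<omega>) (W' (word_take n \<omega>) x) = x}"

lemma atom_space_fixed: "x \<in> atom_space \<omega> \<Longrightarrow> W (word_take n \<omega>) (W' (word_take n \<omega>) x) = x"
  by (simp add: atom_space_def)

lemma atom_space_subspace:
  assumes "\<omega> \<in> words"
  shows "cvec.subspace (atom_space \<omega>)" "closed (atom_space \<omega>)"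
proof -
  have op: "operator_on UNIV (W (word_take n \<omega>) \<circ> W' (word_take n \<omega>))" for n
    using assms by (intro operator_on_compose W_operator W'_operator) auto
  then show "cvec.subspace (atom_space \<omega>)"
    using operator_onD(1,2)[OF op] assms
    by (auto simp: atom_space_def cvec.subspace_def W_0 W'_0)
  have "atom_space \<omega> = (\<Inter>n. {x. (W (word_take n \<omega>) \<circ> W' (word_take n \<omega>)) x = x})"
    by (auto simp: atom_space_def)
  moreover have "closed {x. (W (word_take n \<omega>) \<circ> W' (word_take n \<omega>)) x = x}" for n
    by (intro closed_Collect_eq linear_continuous_on operator_onD(3) op continuous_on_id)
  ultimately show "closed (atom_space \<omega>)"
    by auto
qed

lemma W'_other_atom:
  assumes "x \<in> atom_space \<omega>" "\<omega> \<in> words" "I \<in> finite_words N" "I \<noteq> word_take (length I) \<omega>"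
  shows "W' I x = 0"
  using W'_W[of I "word_take (length I) \<omega>" "W' (word_take (length I) \<omega>) x"] assms
  by (simp add: atom_space_fixed)

lemma atom_space_orthogonal:
  assumes "x \<in> atom_space \<omega>" "y \<in> atom_space \<eta>" "\<omega> \<in> words" "\<eta> \<in> words" "\<omega> \<noteq> \<eta>"
  shows "cinner x y = 0"
proof -
  obtain k where k: "\<omega> k \<noteq> \<eta> k"
    using assms(5) by auto
  define I where "I = word_take (Suc k) \<omega>"
  have "I \<noteq> word_take (Suc k) \<eta>"
    using k nth_word_take[of k "Suc k"] unfolding I_def by (metis lessI)
  then have "W' I y = 0"
    using assms by (intro W'_other_atom[of y \<eta>]) (auto simp: I_def)
  moreover have "cinner x y = cinner (W I (W' I x)) y"
    using assms(1) by (simp add: I_def atom_space_fixed)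
  ultimately show ?thesis
    using assms(3) by (simp add: cinner_W I_def)
qed

lemma W'_atom_space:
  assumes "x \<in> atom_space \<omega>" "\<omega> \<in> words"
  shows "W' (word_take n \<omega>) x \<in> atom_space (word_drop n \<omega>)"
  unfolding atom_space_def
proof (intro CollectI allI)
  fix m
  define I J where "I = word_take n \<omega>" and "J = word_take m (word_drop n \<omega>)"
  have IJ: "I \<in> finite_words N" "J \<in> finite_words N"
    using assms(2) word_drop_words[of \<omega> n] by (auto simp: I_def J_def)
  have "W I (W J (W' J (W' I x))) = x"
    using atom_space_fixed[OF assms(1), of "n + m"] IJ
    by (simp add: word_take_add word_op_append W'_append flip: I_def J_def)
  then have "W' I (W I (W J (W' J (W' I x)))) = W' I x"
    by simp
  then show "W J (W' J (W' I x)) = W' I x"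
    using IJ by (simp add: W'_W)
qed

lemma norm_W'_atom_space:
  assumes "x \<in> atom_space \<omega>" "\<omega> \<in> words"
  shows "norm (W' (word_take n \<omega>) x) = norm x"
  using norm_W[of "word_take n \<omega>" "W' (word_take n \<omega>) x"] assms by (simp add: atom_space_fixed)

lemma atom_spaceI_tail:
  assumes "\<omega> \<in> words" "\<And>m. W (word_take (n + m) \<omega>) (W' (word_take (n + m) \<omega>) x) = x"
  shows "x \<in> atom_space \<omega>"
  unfolding atom_space_def
proof (intro CollectI allI)
  fix k
  define I J where "I = word_take k \<omega>" and "J = word_take n (word_drop k \<omega>)"
  have IJ: "I \<in> finite_words N" "J \<in> finite_words N"
    using assms(1) word_drop_words[of \<omega> k] by (auto simp: I_def J_def)
  have "x = W I (W J (W' (word_take (k + n) \<omega>) x))"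
    using assms(2)[of k] by (simp add: add.commute[of n] word_take_add word_op_append flip: I_def J_def)
  then show "W I (W' I x) = x"
    using IJ by (metis W'_W)
qed

lemma W_atom_space:
  assumes "x \<in> atom_space \<omega>" "\<omega> \<in> words" "I \<in> finite_words N"
  shows "W I x \<in> atom_space (word_append I \<omega>)"
proof (rule atom_spaceI_tail[where n = "length I"])
  fix m
  have "word_take (length I + m) (word_append I \<omega>) = I @ word_take m \<omega>"
    by (simp add: word_take_add)
  then show "W (word_take (length I + m) (word_append I \<omega>))
      (W' (word_take (length I + m) (word_append I \<omega>)) (W I x)) = W I x"
    using assms atom_space_fixed[OF assms(1), of m] by (simp add: word_op_append W'_append W'_W)
qed (use assms word_append_words in auto)

lemma T_atom_space:
  assumes "x \<in> atom_space \<omega>" "\<omega> \<in> words" "i < N"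
  shows "i = \<omega> 0 \<Longrightarrow> T i x \<in> atom_space (word_drop 1 \<omega>)"
    and "i = \<omega> 0 \<Longrightarrow> S i (T i x) = x"
    and "i \<noteq> \<omega> 0 \<Longrightarrow> T i x = 0"
  using W'_atom_space[OF assms(1,2), of 1] atom_space_fixed[OF assms(1), of 1]
    W'_other_atom[OF assms(1,2), of "[i]"] assms(3)
  by (auto simp: word_take_Suc word_op_def)

text \<open>
  A set of vectors on which the adjoints act by following one letter at a time consists of vectors
  in atom spaces: iterating the step spells out the word.
\<close>

lemma in_atom_space_of_coding:
  assumes step: "\<And>x. x \<in> Q \<Longrightarrow> \<exists>i<N. T i x \<in> Q \<and> S i (T i x) = x" and "x \<in> Q"
  shows "\<exists>\<omega>\<in>words. x \<in> atom_space \<omega>"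
proof -
  obtain l where l: "\<And>x. x \<in> Q \<Longrightarrow> l x < N \<and> T (l x) x \<in> Q \<and> S (l x) (T (l x) x) = x"
    using step by metis
  define y where "y n = ((\<lambda>x. T (l x) x) ^^ n) x" for n
  define \<omega> where "\<omega> n = l (y n)" for n
  have yQ: "y n \<in> Q" for n
    by (induction n) (auto simp: y_def assms(2) l)
  have \<omega>: "\<omega> \<in> words"
    using l yQ by (auto simp: \<omega>_def)
  have "W (word_take n \<omega>) (y n) = x" for n
  proof (induction n)
    case (Suc n)
    have "W (word_take (Suc n) \<omega>) (y (Suc n)) = W (word_take n \<omega>) (S (l (y n)) (T (l (y n)) (y n)))"
      using word_take_add[of n 1 \<omega>]
      by (simp add: word_op_append word_take_def word_op_Cons word_drop_def) (simp add: \<omega>_def y_def)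
    then show ?case
      using l yQ Suc by simp
  qed (simp add: y_def)
  then have "W (word_take n \<omega>) (W' (word_take n \<omega>) x) = x" for n
    using W'_W[of "word_take n \<omega>" "word_take n \<omega>" "y n"] \<omega> by simp
  then have "x \<in> atom_space \<omega>"
    by (simp add: atom_space_def)
  then show ?thesis
    using \<omega> by blast
qed


section \<open>Reducing subspaces and cyclicity\<close>

definition reducing :: "'a set \<Rightarrow> bool" where
  "reducing K \<longleftrightarrow> cvec.subspace K \<and> closed K \<and> (\<forall>i<N. \<forall>x\<in>K. S i x \<in> K \<and> T i x \<in> K)"

lemma reducing_W: "reducing K \<Longrightarrow> x \<in> K \<Longrightarrow> I \<in> finite_words N \<Longrightarrow> W I x \<in> K"
  by (induction I) (auto simp: reducing_def word_op_Cons)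

lemma reducing_W': "reducing K \<Longrightarrow> x \<in> K \<Longrightarrow> I \<in> finite_words N \<Longrightarrow> W' I x \<in> K"
  by (induction I arbitrary: x) (auto simp: reducing_def W'_Cons)

lemma closed_span_invariant:
  assumes "operator_on UNIV U" "\<And>x. x \<in> G \<Longrightarrow> U x \<in> closed_span G" "x \<in> closed_span G"
  shows "U x \<in> closed_span G"
proof -
  have "closed_span G \<subseteq> U -` closed_span G"
    using assms(2) operator_vimage_subspace[OF assms(1) closed_span_subspace[of G]]
    by (intro closed_span_minimal) auto
  then show ?thesis
    using assms(3) by blast
qed

lemma reducing_closed_span:
  assumes "\<And>i x. i < N \<Longrightarrow> x \<in> G \<Longrightarrow> S i x \<in> closed_span G"
    and "\<And>i x. i < N \<Longrightarrow> x \<in> G \<Longrightarrow> T i x \<in> closed_span G"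
  shows "reducing (closed_span G)"
  unfolding reducing_def
  using assms closed_span_subspace closed_span_invariant S_operator T_operator by (metis closed_closure)

text \<open>
  The closed span in the definition of cyclicity is the smallest reducing subspace containing \<open>M\<close>, so
  cyclicity can be tested on reducing subspaces without mentioning words.
\<close>

lemma cyclic_iff: "cyclic N S M \<longleftrightarrow> (\<forall>K. reducing K \<longrightarrow> M \<subseteq> K \<longrightarrow> K = UNIV)"
proof -
  define G where "G = {W I (W' J v) | I J v. I \<in> finite_words N \<and> J \<in> finite_words N \<and> v \<in> M}"
  have G_I: "W I (W' J v) \<in> closed_span G" if "I \<in> finite_words N" "J \<in> finite_words N" "v \<in> M" for I J v
    using that closed_span_superset[of G] unfolding G_def by blast
  have "reducing (closed_span G)"
  proof (rule reducing_closed_span)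
    fix i x assume i: "i < N" and "x \<in> G"
    then obtain I J v where x: "x = W I (W' J v)" "I \<in> finite_words N" "J \<in> finite_words N" "v \<in> M"
      by (auto simp: G_def)
    show "S i x \<in> closed_span G"
      using G_I[of "i # I" J v] x i by (simp add: word_op_Cons)
    show "T i x \<in> closed_span G"
    proof (cases I)
      case Nil
      then show ?thesis
        using G_I[of "[]" "J @ [i]" v] x i by (simp add: W'_append W'_Cons)
    next
      case (Cons i' I')
      then show ?thesis
        using G_I[of I' J v] x i cvec.subspace_0[OF closed_span_subspace[of G]]
        by (simp add: word_op_Cons T_S)
    qed
  qed
  moreover have "M \<subseteq> closed_span G"
    using G_I[of "[]" "[]"] by auto
  moreover have "closed_span G \<subseteq> K" if "reducing K" "M \<subseteq> K" for K
    using that reducing_W reducing_W' unfolding G_def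
    by (intro closed_span_minimal) (auto simp: reducing_def)
  ultimately show ?thesis
    unfolding cyclic_def G_def[symmetric] by blast
qed

end

section \<open>The measure of a representation with total atom spaces\<close>

lemma cylinder_open: "openin (infinite_words N) (cylinder N I)"
proof -
  define A where "A k = (if k < length I then {I ! k} \<inter> {..<N} else {..<N})" for k
  have "cylinder N I = Pi\<^sub>E UNIV A"
    unfolding cylinder_def topspace_infinite_words A_def PiE_UNIV_domain Pi_def
    by (auto split: if_splits)
  moreover have "finite {k. A k \<noteq> {..<N}}"
    by (rule finite_subset[of _ "{..<length I}"]) (auto simp: A_def)
  moreover have "A k \<subseteq> {..<N}" for k
    by (auto simp: A_def)
  ultimately show ?thesis
    by (auto simp: infinite_words_def openin_PiE_gen)
qed

lemma space_borel_words: "space (borel_words N) = {\<omega>. \<forall>k. \<omega> k < N}"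
  by (simp add: borel_words_def space_measure_of_conv topspace_infinite_words)

lemma cylinder_sets [measurable]: "cylinder N I \<in> sets (borel_words N)"
proof -
  have "{U. openin (infinite_words N) U} \<subseteq> Pow (topspace (infinite_words N))"
    by (auto dest: openin_subset)
  then show ?thesis
    using cylinder_open by (auto simp: borel_words_def intro: sigma_sets.Basic)
qed

lemma cylinder_iff: "\<omega> \<in> cylinder N I \<longleftrightarrow> (\<forall>k. \<omega> k < N) \<and> word_take (length I) \<omega> = I"
  by (auto simp: cylinder_def topspace_infinite_words list_eq_iff_nth_eq)

lemma singleton_sets:
  assumes "\<And>k. \<omega> k < N"
  shows "{\<omega>} \<in> sets (borel_words N)"
proof -
  have "\<eta> = \<omega>" if "\<And>n. word_take n \<eta> = word_take n \<omega>" for \<eta>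
    using that nth_word_take by (metis ext lessI)
  then have "{\<omega>} = (\<Inter>n. cylinder N (word_take n \<omega>))"
    using assms by (auto simp: cylinder_iff)
  then show ?thesis
    by simp
qed

context cuntz
begin

definition atomic :: bool where
  "atomic \<longleftrightarrow> closed_span (\<Union>\<omega>\<in>words. atom_space \<omega>) = UNIV"

text \<open>
  The atom spaces are pairwise orthogonal, so this formula makes sense for every set of words; on a
  vector of an atom space the projection is the identity or zero. When atom spaces are total, this
  determines the projection, and every law of the measure is checked on such vectors.
\<close>

definition atomic_measure :: "(nat \<Rightarrow> nat) set \<Rightarrow> 'a \<Rightarrow> 'a" where
  "atomic_measure A = proj_onto (closed_span (\<Union>\<omega>\<in>A \<inter> words. atom_space \<omega>))"

lemma atomic_measure_projection:
  shows "orthogonal_projection (atomic_measure A)" "norm (atomic_measure A x) \<le> norm x"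
    and "operator_on UNIV (atomic_measure A)"
proof -
  show *: "orthogonal_projection (atomic_measure A)" "norm (atomic_measure A x) \<le> norm x"
    using orthogonal_projection_proj_onto[OF closed_span_subspace closed_closure]
    unfolding atomic_measure_def by blast+
  show "operator_on UNIV (atomic_measure A)"
    using *(1) by (simp add: orthogonal_projection_def)
qed

lemma atomic_measure_atom:
  assumes "x \<in> atom_space \<omega>" "\<omega> \<in> words"
  shows "atomic_measure A x = (if \<omega> \<in> A then x else 0)"
proof (cases "\<omega> \<in> A")
  case True
  then have "x \<in> closed_span (\<Union>\<omega>\<in>A \<inter> words. atom_space \<omega>)"
    using assms by (intro subsetD[OF closed_span_superset]) auto
  then show ?thesis
    using True proj_onto_same[OF closed_span_subspace] by (simp add: atomic_measure_def)
next
  case False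
  have "proj_onto (closed_span (\<Union>\<omega>\<in>A \<inter> words. atom_space \<omega>)) x = 0"
  proof (rule proj_onto_zero[OF closed_span_subspace])
    fix z assume "z \<in> closed_span (\<Union>\<omega>\<in>A \<inter> words. atom_space \<omega>)"
    moreover have "x \<in> closed_span {x}"
      using closed_span_superset by blast
    ultimately show "cinner x z = 0"
      using False assms by (elim orthogonal_closed_span[rotated]) (auto intro: atom_space_orthogonal[of x \<omega>])
  qed
  then show ?thesis
    using False by (simp add: atomic_measure_def)
qed

lemma atomic_measure_singleton: "\<omega> \<in> words \<Longrightarrow> atomic_measure {\<omega>} x \<in> atom_space \<omega>"
proof -
  assume \<omega>: "\<omega> \<in> words"
  have "atomic_measure {\<omega>} x \<in> closed_span (\<Union>\<eta>\<in>{\<omega>} \<inter> words. atom_space \<eta>)"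
    unfolding atomic_measure_def by (rule proj_onto_in[OF closed_span_subspace closed_closure])
  also have "\<dots> \<subseteq> atom_space \<omega>"
    using \<omega> by (intro closed_span_minimal atom_space_subspace) auto
  finally show ?thesis .
qed

lemma atomic_measure_empty: "atomic_measure {} = (\<lambda>x. 0)"
  using proj_onto_zero[OF closed_span_subspace[of "{}"]] by (auto simp: atomic_measure_def)

lemma atomic_operators_eq:
  assumes "atomic" "operator_on UNIV U" "operator_on UNIV U'"
    and "\<And>\<omega> x. \<omega> \<in> words \<Longrightarrow> x \<in> atom_space \<omega> \<Longrightarrow> U x = U' x"
  shows "U = U'"
  using assms by (intro operators_eq_of_total[of "\<Union>\<omega>\<in>words. atom_space \<omega>"]) (auto simp: atomic_def)

lemma atomic_measure_UNIV: "atomic \<Longrightarrow> words \<subseteq> A \<Longrightarrow> atomic_measure A = id"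
  by (rule atomic_operators_eq)
    (auto simp: atomic_measure_projection operator_on_id atomic_measure_atom)

lemma atomic_measure_0: "atomic_measure A 0 = 0"
  using atomic_measure_projection(2)[of A 0] by simp

lemma atomic_measure_Int: "atomic \<Longrightarrow> atomic_measure (A \<inter> B) = atomic_measure A \<circ> atomic_measure B"
  by (rule atomic_operators_eq)
    (auto simp: atomic_measure_atom atomic_measure_0 intro!: atomic_measure_projection operator_on_compose)

lemma atomic_measure_Un:
  assumes "atomic" "A \<inter> B = {}"
  shows "atomic_measure (A \<union> B) x = atomic_measure A x + atomic_measure B x"
proof -
  have "atomic_measure (A \<union> B) = (\<lambda>x. atomic_measure A x + atomic_measure B x)"
    using assms by (intro atomic_operators_eq)
      (auto simp: atomic_measure_atom intro!: atomic_measure_projection operator_on_add)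
  then show ?thesis
    by simp
qed

lemma atomic_measure_UN:
  assumes "atomic" "finite F" "disjoint_family_on A F"
  shows "atomic_measure (\<Union>k\<in>F. A k) x = (\<Sum>k\<in>F. atomic_measure (A k) x)"
  using assms(2,3)
proof (induction F)
  case (insert k F)
  then have "A k \<inter> (\<Union>j\<in>F. A j) = {}"
    by (auto simp: disjoint_family_on_def)
  then show ?case
    using insert assms(1) by (simp add: atomic_measure_Un disjoint_family_on_def)
qed (simp add: atomic_measure_empty)

lemma atomic_measure_tendsto:
  assumes "atomic" "\<And>\<omega>. \<omega> \<in> words \<Longrightarrow> \<forall>\<^sub>F i in F. \<omega> \<in> A i \<longleftrightarrow> \<omega> \<in> B"
  shows "((\<lambda>i. atomic_measure (A i) x) \<longlongrightarrow> atomic_measure B x) F"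
proof (rule contractions_tendsto_of_total[of "\<Union>\<omega>\<in>words. atom_space \<omega>" "\<lambda>i. atomic_measure (A i)"])
  fix x assume "x \<in> (\<Union>\<omega>\<in>words. atom_space \<omega>)"
  then obtain \<omega> where \<omega>: "\<omega> \<in> words" "x \<in> atom_space \<omega>"
    by blast
  then show "((\<lambda>i. atomic_measure (A i) x) \<longlongrightarrow> atomic_measure B x) F"
    by (intro tendsto_eventually eventually_mono[OF assms(2)[OF \<omega>(1)]])
      (use \<omega> in \<open>auto simp: atomic_measure_atom\<close>)
qed (use assms(1) in \<open>auto simp: atomic_def atomic_measure_projection\<close>)

lemma atomic_measure_cylinder:
  assumes "atomic" "I \<in> finite_words N"
  shows "atomic_measure (cylinder N I) = W I \<circ> W' I"
proof (rule atomic_operators_eq[OF assms(1)])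
  fix \<omega> x assume \<omega>: "\<omega> \<in> words" "x \<in> atom_space \<omega>"
  then show "atomic_measure (cylinder N I) x = (W I \<circ> W' I) x"
    using atom_space_fixed[OF \<omega>(2), of "length I"] W'_other_atom[OF \<omega>(2,1) assms(2)] assms(2)
    by (auto simp: atomic_measure_atom cylinder_iff W_0)
qed (use assms in \<open>auto intro!: atomic_measure_projection operator_on_compose W_operator W'_operator\<close>)

lemma prefix_projections_tendsto:
  assumes "atomic" "\<omega> \<in> words"
  shows "(\<lambda>n. W (word_take n \<omega>) (W' (word_take n \<omega>) x)) \<longlonglongrightarrow> atomic_measure {\<omega>} x"
proof -
  have "(\<lambda>n. atomic_measure (cylinder N (word_take n \<omega>)) x) \<longlonglongrightarrow> atomic_measure {\<omega>} x"
  proof (rule atomic_measure_tendsto[OF assms(1)])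
    fix \<eta> assume \<eta>: "\<eta> \<in> words"
    show "\<forall>\<^sub>F n in sequentially. \<eta> \<in> cylinder N (word_take n \<omega>) \<longleftrightarrow> \<eta> \<in> {\<omega>}"
    proof (cases "\<eta> = \<omega>")
      case False
      then obtain k where "\<eta> k \<noteq> \<omega> k"
        by auto
      then have "\<eta> \<notin> cylinder N (word_take n \<omega>)" if "n > k" for n
        using that by (auto simp: cylinder_iff word_take_def)
      then show ?thesis
        using False by (intro eventually_mono[OF eventually_gt_at_top[of k]]) auto
    qed (use \<eta> in \<open>auto simp: cylinder_iff\<close>)
  qed
  then show ?thesis
    using assms by (simp add: atomic_measure_cylinder)
qed

lemma atomic_has_sum:
  assumes "atomic"
  shows "((\<lambda>\<omega>. atomic_measure {\<omega>} x) has_sum x) words"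
  unfolding has_sum_def
proof (rule Lim_transform_eventually)
  have "((\<lambda>F. atomic_measure F x) \<longlongrightarrow> atomic_measure words x) (finite_subsets_at_top words)"
    using assms
  proof (rule atomic_measure_tendsto)
    fix \<omega> assume "\<omega> \<in> words"
    then show "\<forall>\<^sub>F F in finite_subsets_at_top words. \<omega> \<in> F \<longleftrightarrow> \<omega> \<in> words"
      unfolding eventually_finite_subsets_at_top by (intro exI[of _ "{\<omega>}"]) auto
  qed
  then show "((\<lambda>F. atomic_measure F x) \<longlongrightarrow> x) (finite_subsets_at_top words)"
    using assms by (simp add: atomic_measure_UNIV)
  have "atomic_measure F x = (\<Sum>\<omega>\<in>F. atomic_measure {\<omega>} x)" if "finite F" for F
    using atomic_measure_UN[OF assms that, of "\<lambda>\<omega>. {\<omega>}"] by (auto simp: disjoint_family_on_def)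
  then show "\<forall>\<^sub>F F in finite_subsets_at_top words. atomic_measure F x = (\<Sum>\<omega>\<in>F. atomic_measure {\<omega>} x)"
    by (intro eventually_finite_subsets_at_top_weakI)
qed

lemma atomic_measure_associated:
  assumes "atomic"
  shows "associated_pvm N S atomic_measure"
  unfolding associated_pvm_def projection_valued_measure_def
proof (intro conjI ballI allI impI)
  fix A :: "nat \<Rightarrow> (nat \<Rightarrow> nat) set" and x assume A: "disjoint_family A"
  have "(\<lambda>n. atomic_measure (\<Union>k<n. A k) x) \<longlonglongrightarrow> atomic_measure (\<Union>k. A k) x"
  proof (rule atomic_measure_tendsto[OF assms])
    fix \<omega>
    show "\<forall>\<^sub>F n in sequentially. \<omega> \<in> (\<Union>k<n. A k) \<longleftrightarrow> \<omega> \<in> (\<Union>k. A k)"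
    proof (cases "\<omega> \<in> (\<Union>k. A k)")
      case True
      then obtain k where "\<omega> \<in> A k"
        by blast
      then show ?thesis
        by (intro eventually_mono[OF eventually_gt_at_top[of k]]) auto
    qed auto
  qed
  moreover have "atomic_measure (\<Union>k<n. A k) x = (\<Sum>k<n. atomic_measure (A k) x)" for n
    using A by (intro atomic_measure_UN assms) (auto simp: disjoint_family_on_def)
  ultimately show "(\<lambda>n. atomic_measure (A n) x) sums atomic_measure (\<Union>n. A n) x"
    by (simp add: sums_def)
qed (use assms in \<open>auto simp: atomic_measure_projection atomic_measure_empty atomic_measure_Int
    atomic_measure_UNIV space_borel_words atomic_measure_cylinder\<close>)

text \<open>
  Multiplicativity of the measure puts the range of \<open>P({\<omega>})\<close> into the range of every \<open>P\<close> of a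
  cylinder around \<open>\<omega>\<close>, hence into the atom space.
\<close>

theorem purely_atomic_iff_atomic: "purely_atomic N S \<longleftrightarrow> atomic"
proof
  assume "atomic"
  then show "purely_atomic N S"
    unfolding purely_atomic_def
    by (intro exI[of _ atomic_measure] exI[of _ words])
      (auto simp: atomic_measure_associated topspace_infinite_words atomic_has_sum)
next
  assume "purely_atomic N S"
  then obtain P \<Omega> where P: "associated_pvm N S P" and \<Omega>: "\<Omega> \<subseteq> words"
    and sum: "\<And>x. ((\<lambda>\<omega>. P {\<omega>} x) has_sum x) \<Omega>"
    unfolding purely_atomic_def topspace_infinite_words by blast
  have atom: "P {\<omega>} x \<in> atom_space \<omega>" if \<omega>: "\<omega> \<in> words" for \<omega> x
    unfolding atom_space_def
  proof (intro CollectI allI)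
    fix n
    have "{\<omega>} \<in> sets (borel_words N)"
      using \<omega> by (intro singleton_sets) auto
    then have "P (cylinder N (word_take n \<omega>) \<inter> {\<omega>}) = P (cylinder N (word_take n \<omega>)) \<circ> P {\<omega>}"
      using P unfolding associated_pvm_def projection_valued_measure_def by (metis cylinder_sets)
    moreover have "cylinder N (word_take n \<omega>) \<inter> {\<omega>} = {\<omega>}"
      using \<omega> by (auto simp: cylinder_iff)
    moreover have "P (cylinder N (word_take n \<omega>)) = W (word_take n \<omega>) \<circ> W' (word_take n \<omega>)"
      using P \<omega> word_take_finite_words unfolding associated_pvm_def by blast
    ultimately show "W (word_take n \<omega>) (W' (word_take n \<omega>) (P {\<omega>} x)) = P {\<omega>} x"
      by (metis comp_apply)
  qed
  have "x \<in> closed_span (\<Union>\<omega>\<in>words. atom_space \<omega>)" for x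
  proof (rule Lim_in_closed_set[OF closed_closure])
    show "((\<lambda>F. \<Sum>\<omega>\<in>F. P {\<omega>} x) \<longlongrightarrow> x) (finite_subsets_at_top \<Omega>)"
      using sum unfolding has_sum_def .
    have "(\<Sum>\<omega>\<in>F. P {\<omega>} x) \<in> closed_span (\<Union>\<omega>\<in>words. atom_space \<omega>)" if "F \<subseteq> \<Omega>" for F
      using that atom \<Omega> closure_subset
      by (intro subsetD[OF closure_subset] cvec.span_sum cvec.span_base) blast
    then show "\<forall>\<^sub>F F in finite_subsets_at_top \<Omega>. (\<Sum>\<omega>\<in>F. P {\<omega>} x) \<in> closed_span (\<Union>\<omega>\<in>words. atom_space \<omega>)"
      by (intro eventually_finite_subsets_at_top_weakI)
  qed simp
  then show "atomic"
    by (auto simp: atomic_def)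
qed

end

section \<open>Finite-dimensional invariant subspaces of atomic representations\<close>

definition periodic :: "(nat \<Rightarrow> nat) \<Rightarrow> bool" where
  "periodic \<omega> \<longleftrightarrow> (\<exists>d>0. word_drop d \<omega> = \<omega>)"

lemma word_drop_multiple: "word_drop d \<omega> = \<omega> \<Longrightarrow> word_drop (n * d) \<omega> = \<omega>"
  by (induction n) (auto simp flip: word_drop_drop)

lemma periodic_word_drop: "periodic \<omega> \<Longrightarrow> periodic (word_drop n \<omega>)"
  unfolding periodic_def by (metis word_drop_drop add.commute)

lemma word_append_take_drop: "word_append (word_take n \<omega>) (word_drop n \<omega>) = \<omega>"
  by (auto simp: word_append_def word_drop_def)

locale cuntz_fd = cuntz +
  fixes M :: "'a set"
  assumes finite_dimensional: "\<exists>F. finite F \<and> M = cvec.span F"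
    and invariant: "\<And>i x. i < N \<Longrightarrow> x \<in> M \<Longrightarrow> T i x \<in> M"
begin

lemma M_subspace: "cvec.subspace M" and M_closed: "closed M"
  using finite_dimensional closed_finite_span cvec.subspace_span by auto

lemma M_subsequence:
  fixes x :: "nat \<Rightarrow> 'a"
  assumes "\<And>n. x n \<in> M" "\<And>n. norm (x n) \<le> C"
  obtains l r where "l \<in> M" "strict_mono r" "(\<lambda>n. x (r n)) \<longlonglongrightarrow> l"
proof -
  have "bounded (range x)"
    using assms(2) by (auto simp: bounded_iff)
  then show ?thesis
    using finite_span_bounded_subsequence[of _ x] finite_dimensional assms(1) that by (auto simp: o_def)
qed

lemma W'_M: "I \<in> finite_words N \<Longrightarrow> x \<in> M \<Longrightarrow> W' I x \<in> M"
  by (induction I arbitrary: x) (auto simp: W'_Cons invariant)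

text \<open>
  Poincare recurrence: the vectors obtained by going around the period stay in \<open>M\<close>, so two of them
  are close together, and since going around is isometric, \<open>x\<close> itself is close to one of them.
\<close>

lemma recurrence:
  assumes x: "x \<in> M" "x \<in> atom_space \<omega>" and \<omega>: "\<omega> \<in> words" "word_drop d \<omega> = \<omega>" and e: "e > 0"
  shows "\<exists>n>0. norm (W' (word_take (n * d) \<omega>) x - x) < e"
proof -
  define a where "a n = W' (word_take (n * d) \<omega>) x" for n
  have a_add: "a (n + m) = W' (word_take (m * d) \<omega>) (a n)" for m n
    using \<omega> by (simp add: a_def add_mult_distrib word_take_add word_drop_multiple W'_append)
  have atom: "a n \<in> atom_space \<omega>" for n
    using W'_atom_space[OF x(2) \<omega>(1), of "n * d"] \<omega>(2) by (simp add: a_def word_drop_multiple)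
  have "a n \<in> M" for n
    using x \<omega> by (simp add: a_def W'_M)
  moreover have "norm (a n) \<le> norm x" for n
    using \<omega> by (simp add: a_def norm_W'_le)
  ultimately obtain l r where r: "strict_mono r" "(\<lambda>n. a (r n)) \<longlonglongrightarrow> l"
    using M_subsequence by metis
  have "Cauchy (\<lambda>n. a (r n))"
    using r(2) LIMSEQ_imp_Cauchy by blast
  then obtain J where J: "\<And>i j. i \<ge> J \<Longrightarrow> j \<ge> J \<Longrightarrow> dist (a (r i)) (a (r j)) < e"
    using metric_CauchyD[OF _ e] by blast
  define p n where "p = r J" and "n = r (Suc J) - r J"
  have n: "n > 0" "r (Suc J) = n + p"
    using strict_monoD[OF r(1), of J "Suc J"] by (auto simp: n_def p_def)
  have "cvec.subspace (atom_space \<omega>)"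
    using \<omega> by (intro atom_space_subspace)
  then have "a n - x \<in> atom_space \<omega>"
    using atom x(2) cvec.subspace_diff by blast
  then have "norm (a n - x) = norm (W' (word_take (p * d) \<omega>) (a n - x))"
    using \<omega> by (simp add: norm_W'_atom_space)
  also have "\<dots> = norm (a (n + p) - a (0 + p))"
    using \<omega>(1) unfolding a_add by (simp add: W'_diff a_def)
  also have "\<dots> < e"
    using J[of "Suc J" J] by (simp add: dist_norm n p_def)
  finally show ?thesis
    using n(1) by (auto simp: a_def)
qed

text \<open>
  The hypotheses on \<open>M\<close> concern the adjoints only, but along a periodic word \<open>M\<close> is stable under the
  isometries as well: by recurrence \<open>x\<close> is approximated by some \<open>S\<^sub>K\<^sup>* x\<close> where \<open>K\<close> ends in the first letter
  of \<open>\<eta>\<close>, and \<open>S\<close> of that letter undoes the last step of \<open>S\<^sub>K\<^sup>*\<close>.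
\<close>

lemma S_periodic:
  assumes x: "x \<in> M" "x \<in> atom_space (word_drop 1 \<eta>)" and \<eta>: "\<eta> \<in> words" "periodic \<eta>"
  shows "S (\<eta> 0) x \<in> M"
proof -
  define \<zeta> where "\<zeta> = word_drop 1 \<eta>"
  have \<zeta>: "\<zeta> \<in> words"
    using \<eta> word_drop_words by (simp add: \<zeta>_def)
  obtain d where d: "d > 0" "word_drop d \<eta> = \<eta>"
    using \<eta>(2) by (auto simp: periodic_def)
  have \<zeta>d: "word_drop d \<zeta> = \<zeta>"
    using d(2) by (metis \<zeta>_def word_drop_drop add.commute)
  have "S (\<eta> 0) x \<in> closure M"
    unfolding closure_approachable
  proof (intro allI impI)
    fix e :: real assume e: "e > 0"
    obtain n where n: "n > 0" "norm (W' (word_take (n * d) \<zeta>) x - x) < e"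
      using recurrence[OF x(1) _ \<zeta> \<zeta>d e] x(2) by (auto simp: \<zeta>_def)
    obtain p where p: "n * d = Suc p"
      using n(1) d(1) by (metis mult_pos_pos gr0_implies_Suc)
    define y where "y = W' (word_take p \<zeta>) x"
    have drop: "word_drop p \<zeta> = \<eta>"
      using word_drop_multiple[OF d(2), of n] p by (simp add: \<zeta>_def word_drop_drop)
    have y: "y \<in> M" "y \<in> atom_space \<eta>"
      using W'_atom_space[of x \<zeta> p] x \<zeta> drop by (auto simp: y_def W'_M \<zeta>_def)
    have "W' (word_take (n * d) \<zeta>) x = T (\<eta> 0) y"
      using word_take_add[of p 1 \<zeta>] \<eta>(1) \<zeta>
      by (simp add: p drop W'_append word_take_Suc W'_Cons y_def)
    then have "norm (S (\<eta> 0) (T (\<eta> 0) y - x)) < e"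
      using n(2) norm_W[of "[\<eta> 0]" "T (\<eta> 0) y - x"] \<eta>(1) by (simp add: word_op_Cons)
    moreover have "S (\<eta> 0) (T (\<eta> 0) y - x) = y - S (\<eta> 0) x"
      using W_diff[of "[\<eta> 0]"] \<eta>(1) T_atom_space(2)[OF y(2) \<eta>(1)] by (simp add: word_op_Cons)
    ultimately show "\<exists>y\<in>M. dist y (S (\<eta> 0) x) < e"
      using y(1) by (auto simp: dist_norm)
  qed
  then show ?thesis
    using M_closed by simp
qed

lemma W_periodic:
  assumes "x \<in> M" "x \<in> atom_space (word_drop n \<eta>)" "\<eta> \<in> words" "periodic \<eta>"
  shows "W (word_take n \<eta>) x \<in> M" "W (word_take n \<eta>) x \<in> atom_space \<eta>"
proof -
  have atom: "W (word_take n \<eta>) x \<in> atom_space \<eta>"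
    if "x \<in> atom_space (word_drop n \<eta>)" "\<eta> \<in> words" for n \<eta>
    using W_atom_space[OF that(1) word_drop_words[OF that(2)], of "word_take n \<eta>"] that(2)
    by (simp add: word_append_take_drop)
  then show "W (word_take n \<eta>) x \<in> atom_space \<eta>"
    using assms by blast
  show "W (word_take n \<eta>) x \<in> M"
    using assms(2-4)
  proof (induction n arbitrary: \<eta>)
    case (Suc n)
    have drop: "word_drop 1 \<eta> \<in> words" "periodic (word_drop 1 \<eta>)"
      "word_drop n (word_drop 1 \<eta>) = word_drop (Suc n) \<eta>"
      using Suc.prems word_drop_words periodic_word_drop by (auto simp: word_drop_drop)
    then have "W (word_take n (word_drop 1 \<eta>)) x \<in> M"
      "W (word_take n (word_drop 1 \<eta>)) x \<in> atom_space (word_drop 1 \<eta>)"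
      using Suc atom by auto
    then show ?case
      using Suc.prems S_periodic by (simp add: word_take_Suc word_op_Cons)
  qed (use assms in auto)
qed

text \<open>
  Let \<open>w\<close> be the component of \<open>v \<in> M\<close> in the atom space of \<open>\<omega>\<close>. The vectors \<open>S\<^sub>I\<^sup>* v\<close>, for \<open>I\<close> running through the
  prefixes of \<open>\<omega>\<close>, stay in \<open>M\<close> and approach the vectors \<open>S\<^sub>I\<^sup>* w\<close>, which have constant norm and lie in the
  atom spaces of the shifts of \<open>\<omega>\<close>. By compactness a subsequence converges to some \<open>u \<in> M\<close>. Distinct
  shifts have orthogonal atom spaces, so the shifts along the subsequence eventually agree: the
  word is eventually periodic. Undoing the steps along the period carries \<open>u\<close> to elements of \<open>M\<close> that
  converge to a fixed \<open>S\<^sub>I\<^sup>* w\<close>.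
\<close>

lemma atom_component_eventually_periodic:
  assumes "atomic" and v: "v \<in> M" and \<omega>: "\<omega> \<in> words" and w: "w = atomic_measure {\<omega>} v" "w \<noteq> 0"
  shows "\<exists>k. periodic (word_drop k \<omega>) \<and> W' (word_take k \<omega>) w \<in> M"
proof -
  define a b where "a n = W' (word_take n \<omega>) v" and "b n = W' (word_take n \<omega>) w" for n
  have w_atom: "w \<in> atom_space \<omega>"
    using \<omega> by (simp add: w(1) atomic_measure_singleton)
  have b_atom: "b n \<in> atom_space (word_drop n \<omega>)" for n
    unfolding b_def by (rule W'_atom_space[OF w_atom \<omega>])
  have norm_b: "norm (b n) = norm w" for n
    unfolding b_def by (rule norm_W'_atom_space[OF w_atom \<omega>])
  have "norm (a n - b n) = norm (W (word_take n \<omega>) (W' (word_take n \<omega>) v) - w)" for n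
  proof -
    have "norm (a n - b n) = norm (W (word_take n \<omega>) (a n - b n))"
      using \<omega> by simp
    also have "W (word_take n \<omega>) (a n - b n) = W (word_take n \<omega>) (W' (word_take n \<omega>) v) - w"
      using \<omega> w_atom by (simp add: W_diff a_def b_def atom_space_fixed)
    finally show ?thesis .
  qed
  moreover have "(\<lambda>n. W (word_take n \<omega>) (W' (word_take n \<omega>) v) - w) \<longlonglongrightarrow> 0"
    using LIM_zero[OF prefix_projections_tendsto[OF assms(1) \<omega>, of v]] by (simp add: w(1))
  ultimately have ab: "(\<lambda>n. a n - b n) \<longlonglongrightarrow> 0"
    by (subst tendsto_norm_zero_iff[symmetric]) (simp add: tendsto_norm_zero)
  have "a n \<in> M" "norm (a n) \<le> norm v" for n
    using v \<omega> by (auto simp: a_def W'_M norm_W'_le)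
  then obtain u r where u: "u \<in> M" "strict_mono r" "(\<lambda>n. a (r n)) \<longlonglongrightarrow> u"
    using M_subsequence by metis
  have br: "(\<lambda>n. b (r n)) \<longlonglongrightarrow> u"
    using tendsto_diff[OF u(3) LIMSEQ_subseq_LIMSEQ[OF ab u(2)]] by (simp add: o_def)
  obtain J where J: "\<And>i j. i \<ge> J \<Longrightarrow> j \<ge> J \<Longrightarrow> dist (b (r i)) (b (r j)) < norm w"
    using metric_CauchyD[OF LIMSEQ_imp_Cauchy[OF br], of "norm w"] w(2) by auto
  define \<eta> where "\<eta> = word_drop (r J) \<omega>"
  have \<eta>: "\<eta> \<in> words"
    using \<omega> word_drop_words by (simp add: \<eta>_def)
  (* orthogonal vectors of norm |w| have distance sqrt 2 * |w|, too far apart for indices beyond J *)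
  have shift: "word_drop (r j) \<omega> = \<eta>" if j: "j \<ge> J" for j
  proof (rule ccontr)
    assume "word_drop (r j) \<omega> \<noteq> \<eta>"
    then have "cinner (b (r j)) (- b (r J)) = 0"
      using atom_space_orthogonal[OF b_atom b_atom word_drop_words[OF \<omega>] word_drop_words[OF \<omega>], of "r j" "r J"]
        cinner_diff_right[of "b (r j)" 0 "b (r J)"]
      by (simp add: \<eta>_def)
    from pythagoras[OF this] have "(norm (b (r j) - b (r J)))\<^sup>2 = 2 * (norm w)\<^sup>2"
      by (simp add: norm_b)
    moreover have "(norm (b (r j) - b (r J)))\<^sup>2 < (norm w)\<^sup>2"
      using J[OF j order_refl] by (intro power_strict_mono) (auto simp: dist_norm)
    ultimately show False
      by simp
  qed
  have "r J < r (Suc J)"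
    using u(2) by (simp add: strict_monoD)
  then have "word_drop (r (Suc J) - r J) \<eta> = \<eta>" "r (Suc J) - r J > 0"
    using shift[of "Suc J"] by (auto simp: \<eta>_def word_drop_drop)
  then have periodic: "periodic \<eta>"
    unfolding periodic_def by blast
  have u_atom: "u \<in> atom_space \<eta>"
    using br
  proof (rule Lim_in_closed_set[OF atom_space_subspace(2)[OF \<eta>], rotated -1])
    show "\<forall>\<^sub>F n in sequentially. b (r n) \<in> atom_space \<eta>"
      using b_atom shift by (metis eventually_sequentiallyI)
  qed simp
  have "b (r J) \<in> closure M"
    unfolding closure_approachable
  proof (intro allI impI)
    fix e :: real assume "e > 0"
    then have "\<forall>\<^sub>F j in sequentially. dist (b (r j)) u < e \<and> j \<ge> J"
      using br by (intro eventually_conj eventually_ge_at_top) (auto simp: tendsto_iff)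
    then obtain j where j: "dist (b (r j)) u < e" "j \<ge> J"
      by (auto simp: eventually_sequentially)
    define I where "I = word_take (r j - r J) \<eta>"
    have I: "I \<in> finite_words N"
      using \<eta> by (simp add: I_def)
    have rj: "r j = r J + (r j - r J)"
      using u(2) j(2) by (simp add: strict_mono_less_eq)
    have "word_take (r j) \<omega> = word_take (r J) \<omega> @ I"
      using word_take_add[of "r J" "r j - r J" \<omega>] rj by (simp add: I_def \<eta>_def)
    then have "b (r j) = W' I (b (r J))"
      using \<omega> I by (simp add: b_def W'_append)
    then have "b (r J) = W I (b (r j))"
      using b_atom[of "r J"] by (simp add: I_def \<eta>_def atom_space_fixed)
    then have "dist (W I u) (b (r J)) = norm (W I (u - b (r j)))"
      using I by (simp add: dist_norm W_diff)
    also have "\<dots> < e"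
      using I j(1) by (simp add: dist_norm norm_minus_commute)
    finally have "dist (W I u) (b (r J)) < e" .
    moreover have "word_drop (r j - r J) \<eta> = \<eta>"
      using shift[OF j(2)] rj by (simp add: \<eta>_def word_drop_drop)
    then have "W I u \<in> M"
      using W_periodic(1)[OF u(1) _ \<eta> periodic] u_atom by (simp add: I_def)
    ultimately show "\<exists>y\<in>M. dist y (b (r J)) < e"
      by blast
  qed
  then have "b (r J) \<in> M"
    using M_closed by simp
  then show ?thesis
    using periodic by (auto simp: b_def \<eta>_def)
qed

text \<open>
  The candidate for a smaller cyclic invariant subspace; minimality of \<open>M\<close> forces it to be all of \<open>M\<close>.
\<close>

definition periodic_part :: "'a set" where
  "periodic_part = cvec.span (\<Union>\<eta>\<in>{\<eta> \<in> words. periodic \<eta>}. M \<inter> atom_space \<eta>)"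

lemma periodic_part_I: "\<eta> \<in> words \<Longrightarrow> periodic \<eta> \<Longrightarrow> x \<in> M \<Longrightarrow> x \<in> atom_space \<eta> \<Longrightarrow> x \<in> periodic_part"
  unfolding periodic_part_def by (intro cvec.span_base) auto

lemma periodic_part_subset: "periodic_part \<subseteq> M"
  unfolding periodic_part_def by (intro cvec.span_minimal M_subspace) auto

lemma subspace_of_M:
  assumes "cvec.subspace K" "K \<subseteq> M"
  shows "\<exists>F. finite F \<and> K = cvec.span F" "closed K"
proof -
  show "\<exists>F. finite F \<and> K = cvec.span F"
    using finite_dimensional finite_span_subspace assms by metis
  then show "closed K"
    using closed_finite_span by blast
qed

lemma fd_cyclic_invariant_span:
  assumes "G \<subseteq> M" "\<And>i x. i < N \<Longrightarrow> x \<in> G \<Longrightarrow> T i x \<in> cvec.span G"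
    and "\<And>K. reducing K \<Longrightarrow> G \<subseteq> K \<Longrightarrow> K = UNIV"
  shows "fd_cyclic_invariant N S (cvec.span G)"
proof -
  have sub: "cvec.span G \<subseteq> M"
    using assms(1) M_subspace by (rule cvec.span_minimal)
  have "T i x \<in> cvec.span G" if "i < N" "x \<in> cvec.span G" for i x
  proof -
    have "cvec.span G \<subseteq> T i -` cvec.span G"
      using that(1) assms(2) subspace_of_M(2)[OF cvec.subspace_span sub]
      by (intro cvec.span_minimal operator_vimage_subspace T_operator) auto
    then show ?thesis
      using that(2) by blast
  qed
  moreover have "cyclic N S (cvec.span G)"
    unfolding cyclic_iff using assms(3) cvec.span_superset by blast
  ultimately show ?thesis
    using subspace_of_M(1)[OF cvec.subspace_span sub]
    by (auto simp: fd_cyclic_invariant_def adj_invariant_def)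
qed

lemma T_periodic_atom:
  assumes "\<eta> \<in> words" "periodic \<eta>" "x \<in> M" "x \<in> atom_space \<eta>" "i < N"
  shows "T i x = 0 \<or> (i = \<eta> 0 \<and> T i x \<in> M \<inter> atom_space (word_drop 1 \<eta>))"
  using T_atom_space[OF assms(4,1,5)] invariant assms by auto

text \<open>
  A reducing subspace \<open>K\<close> that contains the periodic part contains every \<open>v \<in> M\<close>: each component \<open>w\<close> of \<open>v\<close> in
  an atom space satisfies \<open>w = S\<^sub>I S\<^sub>I\<^sup>* w\<close>, where \<open>S\<^sub>I\<^sup>* w\<close> is in the periodic part for a suitable prefix \<open>I\<close>.
\<close>

lemma periodic_part_fd_cyclic_invariant:
  assumes "atomic" "cyclic N S M"
  shows "fd_cyclic_invariant N S periodic_part"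
  unfolding periodic_part_def
proof (rule fd_cyclic_invariant_span)
  fix i x assume i: "i < N" and "x \<in> (\<Union>\<eta>\<in>{\<eta> \<in> words. periodic \<eta>}. M \<inter> atom_space \<eta>)"
  then obtain \<eta> where \<eta>: "\<eta> \<in> words" "periodic \<eta>" "x \<in> M" "x \<in> atom_space \<eta>"
    by blast
  have "T i x \<in> periodic_part"
    using T_periodic_atom[OF \<eta> i] periodic_part_I[of "word_drop 1 \<eta>" "T i x"] \<eta> word_drop_words periodic_word_drop
      cvec.span_zero by (auto simp: periodic_part_def)
  then show "T i x \<in> cvec.span (\<Union>\<eta>\<in>{\<eta> \<in> words. periodic \<eta>}. M \<inter> atom_space \<eta>)"
    by (simp add: periodic_part_def)
next
  fix K assume K: "reducing K" "(\<Union>\<eta>\<in>{\<eta> \<in> words. periodic \<eta>}. M \<inter> atom_space \<eta>) \<subseteq> K"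
  have "v \<in> K" if v: "v \<in> M" for v
  proof -
    have K_sub: "cvec.subspace K" "closed K"
      using K(1) by (auto simp: reducing_def)
    have "atomic_measure {\<omega>} v \<in> K" if \<omega>: "\<omega> \<in> words" for \<omega>
    proof (cases "atomic_measure {\<omega>} v = 0")
      case False
      define w where "w = atomic_measure {\<omega>} v"
      have w: "w \<in> atom_space \<omega>"
        using \<omega> by (simp add: w_def atomic_measure_singleton)
      obtain k where k: "periodic (word_drop k \<omega>)" "W' (word_take k \<omega>) w \<in> M"
        using atom_component_eventually_periodic[OF assms(1) v \<omega> w_def] False by (auto simp: w_def)
      then have "W' (word_take k \<omega>) w \<in> K"
        using K(2) W'_atom_space[OF w \<omega>, of k] word_drop_words[OF \<omega>, of k] by blast
      then have "W (word_take k \<omega>) (W' (word_take k \<omega>) w) \<in> K"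
        using \<omega> by (intro reducing_W[OF K(1)]) auto
      then show ?thesis
        using w by (simp add: atom_space_fixed w_def)
    qed (use K_sub cvec.subspace_0 in auto)
    then have "(\<Sum>\<omega>\<in>F. atomic_measure {\<omega>} v) \<in> K" if "F \<subseteq> words" for F
      using that K_sub(1) by (intro cvec.subspace_sum) auto
    then show ?thesis
      using atomic_has_sum[OF assms(1), of v] unfolding has_sum_def
      by (intro Lim_in_closed_set[OF K_sub(2)] eventually_finite_subsets_at_top_weakI) auto
  qed
  then show "K = UNIV"
    using assms(2) K(1) unfolding cyclic_iff by blast
qed auto

end

section \<open>Block permutative and permutative compressions\<close>

context cuntz
begin

lemma S_T_eq: "i < N \<Longrightarrow> norm (T i x) = norm x \<Longrightarrow> S i (T i x) = x"
proof -
  assume i: "i < N" "norm (T i x) = norm x"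
  have "cinner (S i (T i x)) (x - S i (T i x)) = cinner (T i x) (T i (x - S i (T i x)))"
    using i by (simp add: cinner_S_T)
  also have "T i (x - S i (T i x)) = 0"
    using W'_diff[of "[i]" x "S i (T i x)"] i by (simp add: W'_Cons T_S)
  finally have "(norm x)\<^sup>2 = (norm (S i (T i x)))\<^sup>2 + (norm (x - S i (T i x)))\<^sup>2"
    using pythagoras[of "S i (T i x)" "x - S i (T i x)"] by simp
  moreover have "norm (S i (T i x)) = norm x"
    using norm_W[of "[i]" "T i x"] i by (simp add: word_op_Cons)
  ultimately show ?thesis
    by simp
qed

lemma ex_T_nonzero: "x \<noteq> 0 \<Longrightarrow> \<exists>i<N. T i x \<noteq> 0"
proof (rule ccontr)
  assume "x \<noteq> 0" "\<not> (\<exists>i<N. T i x \<noteq> 0)"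
  moreover have "S i 0 = 0" if "i < N" for i
    using W_0[of "[i]"] that by (simp add: word_op_Cons)
  ultimately show False
    using sum_S_T[of x] by simp
qed

lemma reducing_atoms: "reducing (closed_span (\<Union>\<omega>\<in>words. atom_space \<omega>))"
proof (rule reducing_closed_span)
  fix i x assume i: "i < N" and "x \<in> (\<Union>\<omega>\<in>words. atom_space \<omega>)"
  then obtain \<omega> where \<omega>: "\<omega> \<in> words" "x \<in> atom_space \<omega>"
    by blast
  have "S i x \<in> (\<Union>\<omega>\<in>words. atom_space \<omega>)"
    using W_atom_space[OF \<omega>(2,1), of "[i]"] word_append_words[of "[i]" \<omega>] i \<omega> by (auto simp: word_op_Cons)
  then show "S i x \<in> closed_span (\<Union>\<omega>\<in>words. atom_space \<omega>)"
    by (rule closed_span_base)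
  have "T i x = 0 \<or> T i x \<in> (\<Union>\<omega>\<in>words. atom_space \<omega>)"
    using T_atom_space[OF \<omega>(2,1) i] word_drop_words[OF \<omega>(1), of 1] by blast
  then show "T i x \<in> closed_span (\<Union>\<omega>\<in>words. atom_space \<omega>)"
    using closed_span_zero by (auto simp del: UN_iff intro: closed_span_base)
qed

lemma atomicI:
  assumes "cyclic N S M" "M \<subseteq> closed_span G" "G \<subseteq> (\<Union>\<omega>\<in>words. atom_space \<omega>)"
  shows "atomic"
proof -
  have "closed_span G \<subseteq> closed_span (\<Union>\<omega>\<in>words. atom_space \<omega>)"
    using assms(3) by (intro closure_mono cvec.span_mono)
  then show ?thesis
    using assms(1,2) reducing_atoms unfolding cyclic_iff atomic_def by blast
qed

text \<open>
  Unless \<open>x\<close> is zero, the expansion of \<open>x\<close> by the Cuntz relation has a nonzero term, so some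
  letter acts unitarily on the block of \<open>x\<close>; that letter exhausts the norm of \<open>x\<close>.
\<close>

lemma atomic_of_blocks:
  assumes "N > 0" "cyclic N S M" "M \<subseteq> closed_span (\<Union>D)"
    and D: "\<And>A i. A \<in> D \<Longrightarrow> i < N \<Longrightarrow> (\<exists>B\<in>D. unitary_between A B (T i)) \<or> (\<forall>x\<in>A. T i x = 0)"
  shows "atomic"
proof (rule atomicI[OF assms(2,3)])
  have step: "\<exists>i<N. T i x \<in> insert 0 (\<Union>D) \<and> S i (T i x) = x" if x: "x \<in> insert 0 (\<Union>D)" for x
  proof (cases "x = 0")
    case True
    then show ?thesis
      using assms(1) T_0 W_0[of "[0]"] by (auto simp: word_op_Cons)
  next
    case False
    then obtain A where A: "A \<in> D" "x \<in> A"
      using x by blast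
    obtain i where i: "i < N" "T i x \<noteq> 0"
      using ex_T_nonzero[OF False] by blast
    then obtain B where B: "B \<in> D" "unitary_between A B (T i)"
      using D[OF A(1) i(1)] A(2) by blast
    then have "cinner (T i x) (T i x) = cinner x x" "T i x \<in> B"
      using A(2) by (auto simp: unitary_between_def)
    then have "norm (T i x) = norm x"
      unfolding cinner_self of_real_eq_iff by (simp add: power2_eq_iff_nonneg)
    then show ?thesis
      using S_T_eq i(1) \<open>T i x \<in> B\<close> B(1) by blast
  qed
  show "\<Union>D \<subseteq> (\<Union>\<omega>\<in>words. atom_space \<omega>)"
    using in_atom_space_of_coding[of "insert 0 (\<Union>D)", OF step] by blast
qed

text \<open>
  The words applied to the basis of \<open>M\<close> form the basis of the whole space. Two such vectors have
  inner product 0 or 1, because the shorter word cancels and the adjoint of the rest of the longer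
  one maps a basis vector to a basis vector or zero; unit vectors with inner product 1 are equal.
\<close>

lemma permutative_representation_of_basis:
  assumes cyc: "cyclic N S M" and B: "orthonormal_basis_of M B"
    and perm: "\<And>e i. e \<in> B \<Longrightarrow> i < N \<Longrightarrow> T i e \<in> B \<or> T i e = 0"
  shows "permutative_representation N S"
proof -
  define B' where "B' = {W I e | I e. I \<in> finite_words N \<and> e \<in> B}"
  have onb: "cinner e f = (if e = f then 1 else 0)" if "e \<in> B" "f \<in> B" for e f
    using B that by (auto simp: orthonormal_basis_of_def)
  (* 0 is included because an adjoint may kill a basis vector *)
  have perm_W: "W' I e \<in> insert 0 B" if "I \<in> finite_words N" "e \<in> insert 0 B" for I e
    using that by (induction I arbitrary: e) (use perm T_0 in \<open>auto simp: W'_Cons\<close>)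
  have 01: "cinner (W I e) (W J f) \<in> {0, 1}"
    if "I \<in> finite_words N" "J \<in> finite_words N" "e \<in> B" "f \<in> B" "length I \<le> length J" for I J e f
  proof -
    define J1 J2 where "J1 = take (length I) J" and "J2 = drop (length I) J"
    have J: "J = J1 @ J2" "length I = length J1"
      using that(5) by (auto simp: J1_def J2_def)
    then have J_fin: "J1 \<in> finite_words N" "J2 \<in> finite_words N"
      using that(2) by auto
    have "cinner (W I e) (W J f) = cinner e (W' I (W J1 (W J2 f)))"
      using that(1) by (simp add: cinner_W J(1) word_op_append)
    also have "\<dots> = (if I = J1 then cinner e (W J2 f) else 0)"
      using that(1) J_fin J(2) by (simp add: W'_W)
    also have "cinner e (W J2 f) = cnj (cinner f (W' J2 e))"
      using J_fin cinner_commute[of e] by (simp add: cinner_W)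
    finally show ?thesis
      using perm_W[of J2 e] J_fin onb that(3,4) by (auto split: if_splits)
  qed
  have "cinner x y = (if x = y then 1 else 0)" if xy: "x \<in> B'" "y \<in> B'" for x y
  proof -
    obtain I J e f where *: "x = W I e" "y = W J f" "I \<in> finite_words N" "J \<in> finite_words N" "e \<in> B" "f \<in> B"
      using xy by (auto simp: B'_def)
    have unit: "cinner x x = 1" "cinner y y = 1"
      using onb * by (simp_all add: cinner_W W'_W)
    have "cinner x y \<in> {0, 1}"
    proof (cases "length I \<le> length J")
      case False
      then have "cinner y x \<in> {0, 1}"
        using 01[of J I f e] * by simp
      then show ?thesis
        using cinner_commute[of x y] by auto
    qed (use 01[of I J e f] * in simp)
    moreover have "x = y" if "cinner x y = 1"
    proof -
      have "cinner y x = 1"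
        using that cinner_commute[of y x] by simp
      then have "cinner (x - y) (x - y) = 0"
        using that unit by (simp add: cinner_diff_left cinner_diff_right)
      then show ?thesis
        by simp
    qed
    ultimately show ?thesis
      using unit by auto
  qed
  moreover have "closed_span B' = UNIV"
  proof -
    have B'_I: "W I e \<in> closed_span B'" if "I \<in> finite_words N" "e \<in> insert 0 B" for I e
    proof (cases "e = 0")
      case True
      then show ?thesis
        using that closed_span_zero by (simp add: W_0)
    next
      case False
      then have "W I e \<in> B'"
        using that by (auto simp: B'_def)
      then show ?thesis
        by (rule closed_span_base)
    qed
    have "reducing (closed_span B')"
    proof (rule reducing_closed_span)
      fix i x assume i: "i < N" and "x \<in> B'"
      then obtain I e where x: "x = W I e" "I \<in> finite_words N" "e \<in> B"
        by (auto simp: B'_def)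
      show "S i x \<in> closed_span B'"
        using B'_I[of "i # I" e] x i by (simp add: word_op_Cons)
      show "T i x \<in> closed_span B'"
      proof (cases I)
        case Nil
        then show ?thesis
          using B'_I[of "[]" "T i e"] perm[OF x(3) i] x by auto
      next
        case (Cons j J)
        then show ?thesis
          using B'_I[of J e] x i closed_span_zero[of B']
          by (simp add: word_op_Cons T_S)
      qed
    qed
    moreover have "M \<subseteq> closed_span B'"
    proof -
      have "B \<subseteq> closed_span B'"
        using B'_I[of "[]"] by auto
      then have "closed_span B \<subseteq> closed_span B'"
        by (intro closed_span_minimal closed_span_subspace) auto
      then show ?thesis
        using B by (simp add: orthonormal_basis_of_def)
    qed
    ultimately show ?thesis
      using cyc by (simp add: cyclic_iff)
  qed
  moreover have "S j ` B' \<subseteq> B'" if "j < N" for j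
  proof
    fix y assume "y \<in> S j ` B'"
    then obtain I e where "y = W (j # I) e" "I \<in> finite_words N" "e \<in> B"
      by (auto simp: B'_def word_op_Cons)
    then show "y \<in> B'"
      using that unfolding B'_def by force
  qed
  ultimately show ?thesis
    unfolding permutative_representation_def orthonormal_basis_of_def by blast
qed

text \<open>
  The images \<open>S\<^sub>j B\<close> are contained in \<open>B\<close> and together total by the Cuntz relation, so a vector of \<open>B\<close>
  outside all of them would be orthogonal to a total set.
\<close>

lemma permuted_basis_coding:
  assumes B: "orthonormal_basis_of UNIV B" "\<And>j. j < N \<Longrightarrow> S j ` B \<subseteq> B" and e: "e \<in> B"
  shows "\<exists>j<N. T j e \<in> B \<and> S j (T j e) = e"
proof -
  have onb: "cinner e f = (if e = f then 1 else 0)" if "e \<in> B" "f \<in> B" for e f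
    using B that by (auto simp: orthonormal_basis_of_def)
  have "\<exists>j<N. e \<in> S j ` B"
  proof (rule ccontr)
    assume contra: "\<not> (\<exists>j<N. e \<in> S j ` B)"
    have "T j e = 0" if j: "j < N" for j
    proof (rule orthogonal_total_zero)
      show "closed_span B = UNIV"
        using B by (simp add: orthonormal_basis_of_def)
      fix f assume f: "f \<in> B"
      then have "S j f \<in> B" "S j f \<noteq> e"
        using B(2)[OF j] contra j by auto
      then have "cinner (S j f) e = 0"
        using onb e by simp
      then show "cinner f (T j e) = 0"
        using j by (simp add: cinner_S_T)
    qed
    then have "e = 0"
      using ex_T_nonzero by blast
    then show False
      using onb[OF e e] by simp
  qed
  then show ?thesis
    using T_S by auto
qed

end

context cuntz_fd
begin

text \<open>
  The blocks are the pieces \<open>M \<inter> H\<^sub>\<eta>\<close>, where \<open>H\<^sub>\<eta>\<close> is the atom space of a periodic word \<open>\<eta>\<close>. The adjoint of the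
  first letter of \<open>\<eta>\<close> maps the piece of \<open>\<eta>\<close> onto the piece of the shifted word because the isometry of
  that letter maps back into \<open>M\<close>; the other letters vanish on \<open>H\<^sub>\<eta>\<close>.
\<close>

lemma block_permutative_if_periodic:
  assumes M: "M = periodic_part"
    and V: "\<And>i x. i < N \<Longrightarrow> x \<in> M \<Longrightarrow> adjoint_on M (V i) x = T i x"
  shows "block_permutative N M V"
  unfolding block_permutative_def
proof (intro exI conjI ballI allI impI)
  define D where "D = (\<lambda>\<eta>. M \<inter> atom_space \<eta>) ` {\<eta> \<in> words. periodic \<eta>}"
  have "cvec.span (\<Union>D) = M"
    using M unfolding periodic_part_def D_def by simp
  then show "orthogonal_decomposition M D"
    unfolding orthogonal_decomposition_def
  proof (intro conjI ballI impI)
    show "cvec.subspace A" "closed A" if "A \<in> D" for A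
      using that M_closed M_subspace atom_space_subspace by (auto simp: D_def intro: cvec.subspace_inter)
    fix A B x y assume *: "A \<in> D" "B \<in> D" "A \<noteq> B" "x \<in> A" "y \<in> B"
    then obtain \<eta> \<zeta> where "x \<in> atom_space \<eta>" "y \<in> atom_space \<zeta>" "\<eta> \<in> words" "\<zeta> \<in> words" "\<eta> \<noteq> \<zeta>"
      unfolding D_def by blast
    then show "cinner x y = 0"
      by (rule atom_space_orthogonal)
  qed (use M_closed in simp)
  fix A i assume "A \<in> D" and i: "i < N"
  then obtain \<eta> where \<eta>: "A = M \<inter> atom_space \<eta>" "\<eta> \<in> words" "periodic \<eta>"
    by (auto simp: D_def)
  show "(\<exists>B\<in>D. unitary_between A B (adjoint_on M (V i))) \<or> (\<forall>x\<in>A. adjoint_on M (V i) x = 0)"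
  proof (cases "i = \<eta> 0")
    case True
    have "unitary_between A (M \<inter> atom_space (word_drop 1 \<eta>)) (adjoint_on M (V i))"
      unfolding unitary_between_def
    proof (intro conjI ballI)
      show "adjoint_on M (V i) ` A = M \<inter> atom_space (word_drop 1 \<eta>)"
      proof (intro equalityI subsetI)
        fix y assume y: "y \<in> M \<inter> atom_space (word_drop 1 \<eta>)"
        have "S i y \<in> A"
          using W_periodic[of y 1 \<eta>] y \<eta> True by (simp add: word_take_Suc word_op_Cons)
        moreover have "adjoint_on M (V i) (S i y) = y"
          using V[OF i, of "S i y"] \<open>S i y \<in> A\<close> \<eta>(1) i by (simp add: T_S)
        ultimately show "y \<in> adjoint_on M (V i) ` A"
          by (metis imageI)
      qed (use V \<eta> i True T_atom_space(1) invariant in auto)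
      show "cinner (adjoint_on M (V i) x) (adjoint_on M (V i) y) = cinner x y" if "x \<in> A" "y \<in> A" for x y
      proof -
        have "cinner (T i x) (T i y) = cinner (S i (T i x)) y"
          using i by (simp add: cinner_S_T)
        also have "S i (T i x) = x"
          using T_atom_space(2)[of x \<eta> i] that \<eta> i True by auto
        finally show ?thesis
          using V[OF i] that \<eta>(1) by simp
      qed
    qed
    moreover have "M \<inter> atom_space (word_drop 1 \<eta>) \<in> D"
      using \<eta> word_drop_words periodic_word_drop unfolding D_def by blast
    ultimately show ?thesis
      by blast
  next
    case False
    then have "adjoint_on M (V i) x = 0" if "x \<in> A" for x
      using T_atom_space(3)[of x \<eta> i] that \<eta> i V by auto
    then show ?thesis
      by blast
  qed
qed

definition periodic_orbit :: "'a set" where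
  "periodic_orbit = {W I m | I m \<eta>. I \<in> finite_words N \<and> \<eta> \<in> words \<and> periodic \<eta> \<and> m \<in> M \<and> m \<in> atom_space \<eta>}"

lemma periodic_orbit_total:
  assumes "cyclic N S M" "M = periodic_part"
  shows "closed_span periodic_orbit = UNIV"
proof -
  have G_I: "W I m \<in> closed_span periodic_orbit"
    if "I \<in> finite_words N" "\<eta> \<in> words" "periodic \<eta>" "m \<in> M" "m \<in> atom_space \<eta>" for I m \<eta>
    using that by (intro closed_span_base) (auto simp: periodic_orbit_def)
  have "reducing (closed_span periodic_orbit)"
  proof (rule reducing_closed_span)
    fix i x assume i: "i < N" and "x \<in> periodic_orbit"
    then obtain I m \<eta> where x: "x = W I m" "I \<in> finite_words N"
      and \<eta>: "\<eta> \<in> words" "periodic \<eta>" "m \<in> M" "m \<in> atom_space \<eta>"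
      unfolding periodic_orbit_def by blast
    show "S i x \<in> closed_span periodic_orbit"
      using G_I[of "i # I" \<eta> m] x i \<eta> by (simp add: word_op_Cons)
    show "T i x \<in> closed_span periodic_orbit"
    proof (cases I)
      case Nil
      then show ?thesis
        using T_periodic_atom[OF \<eta> i] G_I[of "[]" "word_drop 1 \<eta>" "T i m"] x \<eta> word_drop_words periodic_word_drop
          closed_span_zero[of periodic_orbit] by auto
    next
      case (Cons j J)
      then show ?thesis
        using G_I[of J \<eta> m] x \<eta> i closed_span_zero[of periodic_orbit]
        by (simp add: word_op_Cons T_S)
    qed
  qed
  moreover have "M \<subseteq> closed_span periodic_orbit"
  proof -
    have "periodic_part \<subseteq> closed_span periodic_orbit"
      unfolding periodic_part_def using G_I[of "[]"]
      by (intro cvec.span_minimal closed_span_subspace) auto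
    then show ?thesis
      using assms(2) by simp
  qed
  ultimately show ?thesis
    using assms(1) by (simp add: cyclic_iff)
qed

text \<open>
  Projecting the total set \<open>periodic_orbit\<close> to the atom space of \<open>\<eta>\<close> kills all vectors except those of the
  form \<open>S\<^sub>I m\<close> with \<open>I\<close> a prefix of \<open>\<eta>\<close> and \<open>m\<close> in the piece of the shifted word; these are in \<open>M\<close>. By density
  the whole projection has range in \<open>M\<close>.
\<close>

lemma periodic_atom_space_subset:
  assumes "atomic" "cyclic N S M" "M = periodic_part" and \<eta>: "\<eta> \<in> words" "periodic \<eta>"
  shows "atom_space \<eta> \<subseteq> M"
proof
  fix x assume x: "x \<in> atom_space \<eta>"
  have "periodic_orbit \<subseteq> atomic_measure {\<eta>} -` M"
  proof
    fix y assume "y \<in> periodic_orbit"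
    then obtain I m \<zeta> where y: "y = W I m" "I \<in> finite_words N" "\<zeta> \<in> words" "m \<in> M" "m \<in> atom_space \<zeta>"
      unfolding periodic_orbit_def by blast
    have y_atom: "y \<in> atom_space (word_append I \<zeta>)" "word_append I \<zeta> \<in> words"
      using y W_atom_space word_append_words by auto
    show "y \<in> atomic_measure {\<eta>} -` M"
    proof (cases "word_append I \<zeta> = \<eta>")
      case True
      then have "word_take (length I) \<eta> = I" "word_drop (length I) \<eta> = \<zeta>"
        by auto
      then have "y \<in> M"
        using W_periodic(1)[of m "length I" \<eta>] y \<eta> by simp
      then show ?thesis
        using atomic_measure_atom[OF y_atom] True by simp
    next
      case False
      then show ?thesis
        using atomic_measure_atom[OF y_atom, of "{\<eta>}"] cvec.subspace_0[OF M_subspace] by simp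
    qed
  qed
  then have "closed_span periodic_orbit \<subseteq> atomic_measure {\<eta>} -` M"
    using operator_vimage_subspace[OF atomic_measure_projection(3) M_subspace M_closed]
    by (rule closed_span_minimal)
  then have "atomic_measure {\<eta>} x \<in> M"
    using periodic_orbit_total[OF assms(2,3)] by auto
  then show "x \<in> M"
    using atomic_measure_atom[OF x \<eta>(1)] by simp
qed

text \<open>
  The permuted basis of \<open>M\<close> is \<open>B \<inter> M\<close>, where \<open>B\<close> is the permuted basis of the whole space. A vector of \<open>B\<close> lies in the
  atom space of some \<open>\<omega>\<close> and is not orthogonal to \<open>periodic_orbit\<close>, so a shift of \<open>\<omega>\<close> is periodic and the
  corresponding \<open>S\<^sub>I\<^sup>*\<close> carries the vector into an atom space contained in \<open>M\<close>. Hence \<open>B \<inter> M\<close> generates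
  everything, and minimality makes its span equal to \<open>M\<close>.
\<close>

lemma permutative_if_permutative_representation:
  assumes cyc: "cyclic N S M"
    and minimal: "\<And>M'. fd_cyclic_invariant N S M' \<Longrightarrow> M' \<subseteq> M \<Longrightarrow> M' = M"
    and V: "\<And>i x. i < N \<Longrightarrow> x \<in> M \<Longrightarrow> adjoint_on M (V i) x = T i x"
    and perm: "permutative_representation N S"
  shows "permutative N M V"
proof -
  obtain B where B: "orthonormal_basis_of UNIV B" "\<And>j. j < N \<Longrightarrow> S j ` B \<subseteq> B"
    using perm by (auto simp: permutative_representation_def)
  have onb: "cinner e f = (if e = f then 1 else 0)" if "e \<in> B" "f \<in> B" for e f
    using B that by (auto simp: orthonormal_basis_of_def)
  have total: "closed_span B = UNIV"
    using B by (simp add: orthonormal_basis_of_def)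
  note coding = permuted_basis_coding[OF B]
  have T_B: "T i e \<in> insert 0 B" if i: "i < N" and e: "e \<in> insert 0 B" for i e
  proof (cases "e = 0")
    case False
    then obtain j where "j < N" "T j e \<in> B" "S j (T j e) = e"
      using coding e by blast
    then show ?thesis
      using T_S[OF i, of j "T j e"] by (auto split: if_splits)
  qed (use i T_0 in auto)
  have atoms: "\<exists>\<omega>\<in>words. e \<in> atom_space \<omega>" if "e \<in> B" for e
    using in_atom_space_of_coding[of B, OF coding that] by blast
  have "atomic"
    using atomicI[OF cyc, of B] total atoms by blast
  then have M: "M = periodic_part"
    using minimal periodic_part_fd_cyclic_invariant[OF _ cyc] periodic_part_subset by metis
  have from_M: "\<exists>I\<in>finite_words N. \<exists>f\<in>B \<inter> M. e = W I f" if e: "e \<in> B" for e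
  proof -
    obtain \<omega> where \<omega>: "\<omega> \<in> words" "e \<in> atom_space \<omega>"
      using atoms[OF e] by blast
    have "e \<noteq> 0"
      using onb[OF e e] by auto
    then obtain I m \<eta> where *: "I \<in> finite_words N" "\<eta> \<in> words" "periodic \<eta>" "m \<in> M" "m \<in> atom_space \<eta>"
      "cinner (W I m) e \<noteq> 0"
      using orthogonal_total_zero[OF periodic_orbit_total[OF cyc M], of e]
      unfolding periodic_orbit_def by blast
    then have \<omega>_eq: "word_append I \<eta> = \<omega>"
      using atom_space_orthogonal[OF W_atom_space[OF *(5,2,1)] \<omega>(2) word_append_words[OF *(1,2)] \<omega>(1)]
      by blast
    then have I: "word_take (length I) \<omega> = I" "word_drop (length I) \<omega> = \<eta>"
      by auto
    have e_eq: "e = W I (W' I e)"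
      using atom_space_fixed[OF \<omega>(2), of "length I"] I by simp
    have "W' I e \<in> M"
      using W'_atom_space[OF \<omega>(2,1), of "length I"] I periodic_atom_space_subset[OF \<open>atomic\<close> cyc M] * by auto
    moreover have "W' I f \<in> insert 0 B" if "f \<in> insert 0 B" "I \<in> finite_words N" for I f
      using that by (induction I arbitrary: f) (use T_B in \<open>auto simp: W'_Cons\<close>)
    then have "W' I e \<in> insert 0 B"
      using e *(1) by blast
    then have "W' I e \<in> B"
      using e_eq \<open>e \<noteq> 0\<close> W_0[OF *(1)] by auto
    ultimately show ?thesis
      using e_eq *(1) by blast
  qed
  have T_BM: "T i e \<in> insert 0 (B \<inter> M)" if "i < N" "e \<in> B \<inter> M" for i e
    using T_B[of i e] invariant[of i e] that by auto
  have "fd_cyclic_invariant N S (cvec.span (B \<inter> M))"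
  proof (rule fd_cyclic_invariant_span)
    show "T i e \<in> cvec.span (B \<inter> M)" if "i < N" "e \<in> B \<inter> M" for i e
      using T_BM[OF that] cvec.span_zero[of "B \<inter> M"] cvec.span_base[of "T i e" "B \<inter> M"] by auto
    fix K assume K: "reducing K" "B \<inter> M \<subseteq> K"
    then have "B \<subseteq> K"
      using from_M reducing_W[OF K(1)] by blast
    then have "closed_span B \<subseteq> K"
      using K(1) by (intro closed_span_minimal) (auto simp: reducing_def)
    then show "K = UNIV"
      using total by blast
  qed auto
  then have "cvec.span (B \<inter> M) = M"
    using minimal cvec.span_minimal[OF _ M_subspace, of "B \<inter> M"] by blast
  then have "orthonormal_basis_of M (B \<inter> M)"
    using onb M_closed by (simp add: orthonormal_basis_of_def)
  moreover have "adjoint_on M (V i) e \<in> B \<inter> M \<or> adjoint_on M (V i) e = 0" if "e \<in> B \<inter> M" "i < N" for e i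
    using V[OF that(2), of e] T_BM[OF that(2,1)] that(1) by auto
  ultimately show ?thesis
    unfolding permutative_def by blast
qed

end

theorem theorem5p14:
  fixes N :: nat
    and S :: "nat \<Rightarrow> 'a::complex_hilbert_space \<Rightarrow> 'a"
    and M :: "'a set"
    and V :: "nat \<Rightarrow> 'a \<Rightarrow> 'a"
  assumes "N \<ge> 2"
    and "cuntz_representation N S"
    and "minimal_fd_cyclic_invariant N S M"
    and "\<And>i. i < N \<Longrightarrow> operator_on M (V i)"
    and "\<And>i x. i < N \<Longrightarrow> x \<in> M \<Longrightarrow> adjoint_on M (V i) x = adj (S i) (proj_onto M x)"
  shows "(purely_atomic N S \<longleftrightarrow> block_permutative N M V) \<and>
         (permutative_representation N S \<longleftrightarrow> permutative N M V)"
proof -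
  have M: "cvec.subspace M" "\<exists>F. finite F \<and> M = cvec.span F" "adj_invariant N S M" and cyc: "cyclic N S M"
    and minimal: "\<And>M'. fd_cyclic_invariant N S M' \<Longrightarrow> M' \<subseteq> M \<Longrightarrow> M' = M"
    using assms(3) by (auto simp: minimal_fd_cyclic_invariant_def fd_cyclic_invariant_def)
  interpret cuntz_fd N S M
    using assms(2) M by unfold_locales (auto simp: adj_invariant_def)
  have V: "adjoint_on M (V i) x = T i x" if "i < N" "x \<in> M" for i x
    using assms(5)[OF that] proj_onto_same[OF M(1) that(2)] by simp
  show ?thesis
  proof (intro conjI iffI)
    assume "purely_atomic N S"
    then have "fd_cyclic_invariant N S periodic_part"
      using cyc by (simp add: purely_atomic_iff_atomic periodic_part_fd_cyclic_invariant)
    then have "M = periodic_part"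
      using minimal periodic_part_subset by metis
    then show "block_permutative N M V"
      using V by (rule block_permutative_if_periodic)
  next
    assume "block_permutative N M V"
    then obtain D where D: "orthogonal_decomposition M D"
      "\<And>A i. A \<in> D \<Longrightarrow> i < N \<Longrightarrow> (\<exists>B\<in>D. unitary_between A B (adjoint_on M (V i))) \<or> (\<forall>x\<in>A. adjoint_on M (V i) x = 0)"
      unfolding block_permutative_def by blast
    have span: "closed_span (\<Union>D) = M"
      using D(1) by (simp add: orthogonal_decomposition_def)
    have V_D: "adjoint_on M (V i) x = T i x" if "i < N" "A \<in> D" "x \<in> A" for i A x
      using V[of i x] that span closed_span_base[of x "\<Union>D"] by auto
    then have "unitary_between A B (adjoint_on M (V i)) \<longleftrightarrow> unitary_between A B (T i)"
      if "i < N" "A \<in> D" for i A B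
      using that unfolding unitary_between_def by (simp cong: image_cong)
    then have "(\<exists>B\<in>D. unitary_between A B (T i)) \<or> (\<forall>x\<in>A. T i x = 0)" if "A \<in> D" "i < N" for A i
      using D(2)[OF that] V_D[OF that(2,1)] that by auto
    then show "purely_atomic N S"
      unfolding purely_atomic_iff_atomic using assms(1) span by (intro atomic_of_blocks[OF _ cyc, of D]) auto
  next
    assume "permutative_representation N S"
    then show "permutative N M V"
      by (intro permutative_if_permutative_representation cyc minimal V)
  next
    assume "permutative N M V"
    then obtain B where B: "orthonormal_basis_of M B"
      "\<And>e i. e \<in> B \<Longrightarrow> i < N \<Longrightarrow> adjoint_on M (V i) e \<in> B \<or> adjoint_on M (V i) e = 0"
      unfolding permutative_def by blast
    have "B \<subseteq> M"
      using B(1) closed_span_superset[of B] by (simp add: orthonormal_basis_of_def)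
    then show "permutative_representation N S"
      using B V by (intro permutative_representation_of_basis[OF cyc B(1)]) (metis subsetD)
  qed
qed

end
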